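(* If $1<p<2$, $1/p+1/q=1$, and a set $E\subseteq\mathbb R$ has property $\mathrm{LP}(p)$, then $\dim E\le 2/q$. Consequently, if $E\subseteq\mathbb R$ has property $\mathrm{LP}$, then $\dim E=0$.
   Context: Here $\dim$ denotes Hausdorff dimension. Properties $\mathrm{LP}(p)$ and $\mathrm{LP}$ (defined for closed sets of Lebesgue measure zero; saying that a set has one of these properties includes that it is such a set). Let $E\subseteq\mathbb R$ be a closed set of Lebesgue measure zero, and let $I_k$, $k=1,2,\ldots$, be the intervals complementary to $E$, i.e. the (finitely or countably many) connected components of $\mathbb R\setminus E$ (unbounded components included). Let $S_k$ be the operator defined by $\widehat{S_kf}=1_{I_k}\cdot\widehat f$ for $f\in L^2\cap L^p(\mathbb R)$, where $1_{I_k}$ is the characteristic function of $I_k$ and $\widehat{\ }$ is the Fourier transform (extended to $L^p(\mathbb R)$ by density). Put $S(f)=\left(\sum_k|S_kf|^2\right)^{1/2}$. For $1<p<\infty$, the set $E$ has property $\mathrm{LP}(p)$ if there are positive constants $c_1,c_2$ independent of $f$ such that $c_1\|f\|_{L^p(\mathbb R)}\le\|S(f)\|_{L^p(\mathbb R)}\le c_2\|f\|_{L^p(\mathbb R)}$ for all $f\in L^p(\mathbb R)$. The set $E$ has property $\mathrm{LP}$ if it has property $\mathrm{LP}(p)$ for all $p$, $1<p<\infty$. *)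

theory Defs
  imports "HOL-Analysis.Analysis"
begin

section \<open>Hausdorff dimension\<close>

text \<open>Covering sets are required to be bounded because \<open>diameter\<close> is
  unspecified on unbounded sets.\<close>

definition hausdorff_premeasure :: "real \<Rightarrow> real \<Rightarrow> 'a::metric_space set \<Rightarrow> ennreal" where
  "hausdorff_premeasure s \<delta> A =
     (INF U \<in> {U :: nat \<Rightarrow> 'a set. A \<subseteq> (\<Union>i. U i) \<and> (\<forall>i. bounded (U i) \<and> diameter (U i) \<le> \<delta>)}.
        \<Sum>i. ennreal (diameter (U i) powr s))"

definition hausdorff_measure :: "real \<Rightarrow> 'a::metric_space set \<Rightarrow> ennreal" where
  "hausdorff_measure s A = (SUP \<delta> \<in> {0<..}. hausdorff_premeasure s \<delta> A)"

text \<open>The exponent \<open>s = 0\<close> is left out since \<open>0 powr 0 = 0\<close> in HOL; this does not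
  affect the infimum, because \<open>s \<mapsto> hausdorff_measure s A\<close> vanishes on an up-closed set
  of exponents.\<close>

definition hausdorff_dim :: "'a::metric_space set \<Rightarrow> ereal" where
  "hausdorff_dim A = (INF s \<in> {s. 0 < s \<and> hausdorff_measure s A = 0}. ereal s)"

section \<open>Lebesgue spaces on the real line\<close>

text \<open>Elements of \<open>L\<^sup>p\<close> are handled through Borel representatives.\<close>

definition in_Lp :: "real \<Rightarrow> (real \<Rightarrow> 'a::real_normed_vector) \<Rightarrow> bool" where
  "in_Lp p f \<longleftrightarrow> f \<in> borel_measurable lborel \<and> integrable lborel (\<lambda>x. norm (f x) powr p)"

definition Lp_norm :: "real \<Rightarrow> (real \<Rightarrow> 'a::real_normed_vector) \<Rightarrow> real" where
  "Lp_norm p f = (\<integral>x. norm (f x) powr p \<partial>lborel) powr (1 / p)"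

text \<open>The membership clause is needed: the Bochner integral of a nonintegrable function is \<open>0\<close>.\<close>

definition Lp_tendsto ::
    "real \<Rightarrow> (nat \<Rightarrow> real \<Rightarrow> 'a::real_normed_vector) \<Rightarrow> (real \<Rightarrow> 'a) \<Rightarrow> bool" where
  "Lp_tendsto p \<phi> f \<longleftrightarrow> (\<forall>n. in_Lp p (\<lambda>x. \<phi> n x - f x)) \<and>
     (\<lambda>n. Lp_norm p (\<lambda>x. \<phi> n x - f x)) \<longlonglongrightarrow> 0"

section \<open>Fourier transform\<close>

definition fourier_L1 :: "(real \<Rightarrow> complex) \<Rightarrow> real \<Rightarrow> complex" where
  "fourier_L1 f \<xi> = (\<integral>x. f x * cis (- (x * \<xi>)) \<partial>lborel)"

text \<open>\<open>fourier_L2 f g\<close>: \<open>g\<close> represents the Fourier transform of \<open>f \<in> L\<^sup>2\<close>, i.e.\ the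
  continuous extension of the integral formula from \<open>L\<^sup>1 \<inter> L\<^sup>2\<close> to \<open>L\<^sup>2\<close>.\<close>

definition fourier_L2 :: "(real \<Rightarrow> complex) \<Rightarrow> (real \<Rightarrow> complex) \<Rightarrow> bool" where
  "fourier_L2 f g \<longleftrightarrow> in_Lp 2 f \<and> in_Lp 2 g \<and>
     (\<exists>\<phi>. (\<forall>n. in_Lp 1 (\<phi> n) \<and> in_Lp 2 (\<phi> n)) \<and>
          Lp_tendsto 2 \<phi> f \<and> Lp_tendsto 2 (\<lambda>n. fourier_L1 (\<phi> n)) g)"

section \<open>The operators of multiplication by an indicator on the Fourier side\<close>

text \<open>\<open>proj_L2 I f h\<close>: \<open>h\<close> represents \<open>S\<^sub>I f\<close>, whose Fourier transform is the indicator
  function of \<open>I\<close> times that of \<open>f\<close>.\<close>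

definition proj_L2 :: "real set \<Rightarrow> (real \<Rightarrow> complex) \<Rightarrow> (real \<Rightarrow> complex) \<Rightarrow> bool" where
  "proj_L2 I f h \<longleftrightarrow> (\<exists>g. fourier_L2 f g \<and> fourier_L2 h (\<lambda>\<xi>. indicator I \<xi> * g \<xi>))"

text \<open>The extension of \<open>S\<^sub>I\<close> from \<open>L\<^sup>2 \<inter> L\<^sup>p\<close> to \<open>L\<^sup>p\<close> by density. For an interval \<open>I\<close> and
  \<open>1 < p < \<infinity>\<close> this relation is an operator (up to null sets), by M. Riesz's theorem.\<close>

definition proj_Lp :: "real \<Rightarrow> real set \<Rightarrow> (real \<Rightarrow> complex) \<Rightarrow> (real \<Rightarrow> complex) \<Rightarrow> bool" where
  "proj_Lp p I f h \<longleftrightarrow> in_Lp p f \<and> in_Lp p h \<and>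
     (\<exists>\<phi> \<psi>. (\<forall>n. in_Lp 2 (\<phi> n) \<and> in_Lp p (\<phi> n) \<and> proj_L2 I (\<phi> n) (\<psi> n)) \<and>
            Lp_tendsto p \<phi> f \<and> Lp_tendsto p \<psi> h)"

section \<open>The Littlewood--Paley property\<close>

text \<open>The complementary intervals are their own indices: \<open>h I\<close> stands for \<open>S\<^sub>I f\<close>.\<close>

definition square_function ::
    "real set \<Rightarrow> (real set \<Rightarrow> real \<Rightarrow> complex) \<Rightarrow> real \<Rightarrow> real" where
  "square_function E h x = sqrt (\<Sum>\<^sub>\<infinity>I\<in>components (- E). (cmod (h I x))\<^sup>2)"

text \<open>Summability almost everywhere and membership of the square function in \<open>L\<^sup>p\<close> say that
  the middle term of the two-sided estimate is the norm of a genuine \<open>L\<^sup>p\<close> function. The first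
  conjunct under \<open>\<forall>f\<close>, existence of all \<open>S\<^sub>I f\<close>, holds automatically.\<close>

definition LP_p :: "real \<Rightarrow> real set \<Rightarrow> bool" where
  "LP_p p E \<longleftrightarrow> closed E \<and> emeasure lborel E = 0 \<and>
     (\<exists>c1>0. \<exists>c2>0. \<forall>f :: real \<Rightarrow> complex. in_Lp p f \<longrightarrow>
        (\<forall>I\<in>components (- E). \<exists>g. proj_Lp p I f g) \<and>
        (\<forall>h. (\<forall>I\<in>components (- E). proj_Lp p I f (h I)) \<longrightarrow>
           (AE x in lborel. (\<lambda>I. (cmod (h I x))\<^sup>2) summable_on components (- E)) \<and>
           in_Lp p (square_function E h) \<and>
           c1 * Lp_norm p f \<le> Lp_norm p (square_function E h) \<and>
           Lp_norm p (square_function E h) \<le> c2 * Lp_norm p f))"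

definition LP :: "real set \<Rightarrow> bool" where
  "LP E \<longleftrightarrow> (\<forall>p>1. LP_p p E)"

end

theory Submission
  imports Defs
begin

text \<open>Test the upper estimate on the function \<open>f\<close> whose Fourier transform is the indicator of an
  interval \<open>(c, d)\<close>. For every gap \<open>I\<close> of \<open>E\<close> of length \<open>l\<close> inside \<open>(c, d)\<close> one has
  \<open>\<bar>S\<^sub>I f(x)\<bar> = \<bar>sin (l x / 2)\<bar> / (\<pi> \<bar>x\<bar>)\<close>. If \<open>N\<close> of these gaps have length at least \<open>\<delta>\<close>, then
  for \<open>4 / \<delta> \<le> x \<le> 8 / \<delta>\<close> each \<open>sin\<^sup>2 (l x / 2)\<close> has mean at least \<open>1 / 4\<close>, so that the \<open>p\<close>-th power
  of the norm of the square function is at least a constant times \<open>N powr (p / 2) * \<delta> powr (p - 1)\<close>.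
  Hence \<open>N = O(\<delta> powr (- \<alpha>))\<close> with \<open>\<alpha> = 2 (p - 1) / p = 2 / q < 1\<close>.

  Since \<open>E\<close> is a null set, a cell of a grid of mesh \<open>\<delta>\<close> that meets \<open>E\<close> either contains an endpoint of
  one of the \<open>N\<close> long gaps or is filled up to a null set by gaps shorter than \<open>\<delta>\<close>. The latter have total
  length \<open>O(\<delta> powr (1 - \<alpha>))\<close> by dyadic summation, so \<open>O(\<delta> powr (- \<alpha>))\<close> cells suffice to cover
  \<open>E \<inter> [c, d]\<close>.\<close>

subsection \<open>Fourier transform of the two-sided exponential\<close>

lemma borel_measurable_cis [measurable]: "cis \<in> borel_measurable borel"
  by (intro borel_measurable_continuous_onI continuous_intros)

lemma integrable_reflect_real:
  fixes f :: "real \<Rightarrow> 'a::{banach, second_countable_topology}"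
  assumes "integrable lborel f"
  shows "integrable lborel (\<lambda>x. f (- x))"
  using lborel_integrable_real_affine[OF assms, of "-1" 0] by simp

lemma integral_reflect_real:
  fixes f :: "real \<Rightarrow> 'a::{banach, second_countable_topology}"
  shows "(\<integral>x. f (- x) \<partial>lborel) = (\<integral>x. f x \<partial>lborel)"
  using lborel_integral_real_affine[of "-1" f 0] by simp

lemma integrable_powr_atLeast_1:
  assumes "1 < (p::real)"
  shows "integrable lborel (\<lambda>x::real. x powr (- p) * indicator {1..} x)"
proof (rule integrableI_nonneg)
  have lim: "((\<lambda>x::real. x powr (1 - p) / (1 - p)) \<longlongrightarrow> 0 / (1 - p)) at_top"
    using assms by (intro tendsto_divide tendsto_neg_powr filterlim_ident) auto
  have "(\<integral>\<^sup>+x. ennreal (x powr (- p)) * indicator {1..} x \<partial>lborel)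
      = ennreal (0 / (1 - p) - 1 powr (1 - p) / (1 - p))"
  proof (rule nn_integral_FTC_atLeast[OF _ _ _ lim])
    show "((\<lambda>x. x powr (1 - p) / (1 - p)) has_real_derivative x powr (- p)) (at x)" if "1 \<le> x" for x
    proof -
      have "((\<lambda>x. x powr (1 - p) / (1 - p)) has_real_derivative
          ((1 - p) * x powr (1 - p - 1)) / (1 - p)) (at x)"
        using that by (intro DERIV_cdivide has_real_derivative_powr) auto
      then show ?thesis using assms by simp
    qed
  qed auto
  then show "(\<integral>\<^sup>+x. ennreal (x powr (- p) * indicator {1..} x) \<partial>lborel) < \<infinity>"
    by (simp add: ennreal_mult' ennreal_indicator)
qed auto

lemma integrable_exp_half_line:
  assumes "0 < (e::real)"
  shows "integrable lborel (\<lambda>x::real. exp (- e * x) * indicator {0..} x)"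
proof (rule integrableI_nonneg)
  have "filterlim (\<lambda>x. - (e * x)) at_bot at_top"
    using assms by (intro filterlim_compose[OF filterlim_uminus_at_bot_at_top]
        filterlim_tendsto_pos_mult_at_top[OF tendsto_const _ filterlim_ident]) auto
  then have lim: "((\<lambda>x. exp (- (e * x)) / (- e)) \<longlongrightarrow> 0 / (- e)) at_top"
    using assms by (intro tendsto_divide filterlim_compose[OF exp_at_bot]) auto
  have "(\<integral>\<^sup>+x. ennreal (exp (- e * x)) * indicator {0..} x \<partial>lborel)
      = ennreal (0 / (- e) - exp (- (e * 0)) / (- e))"
    by (rule nn_integral_FTC_atLeast[OF _ _ _ lim])
      (use assms in \<open>auto intro!: derivative_eq_intros simp: field_simps\<close>)
  then show "(\<integral>\<^sup>+x. ennreal (exp (- e * x) * indicator {0..} x) \<partial>lborel) < \<infinity>"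
    by (simp add: ennreal_mult' ennreal_indicator)
qed auto

lemma integrable_exp_abs:
  assumes "0 < (e::real)"
  shows "integrable lborel (\<lambda>x::real. exp (- e * \<bar>x\<bar>))"
proof (rule Bochner_Integration.integrable_bound)
  show "integrable lborel (\<lambda>x. exp (- e * x) * indicator {0..} x + exp (- e * (- x)) * indicator {0..} (- x))"
    using integrable_exp_half_line[OF assms] integrable_reflect_real[OF integrable_exp_half_line[OF assms]]
    by (rule Bochner_Integration.integrable_add)
  show "AE x in lborel. norm (exp (- e * \<bar>x\<bar>))
      \<le> norm (exp (- e * x) * indicator {0..} x + exp (- e * (- x)) * indicator {0..} (- x))"
    by (intro always_eventually allI) (auto simp: indicator_def)
qed simp

text \<open>\<open>Complex e (- t)\<close> is the number e - i t, so the integrand is exp (- (e - i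
  t) x), with an antiderivative that vanishes at infinity because \<open>e\<close> is positive. The
  half line is open so that it equals \<open>einterval 0 \<infinity>\<close>.\<close>

lemma integral_exp_cis_half_line:
  assumes "0 < (e::real)"
  shows "(\<integral>x. indicator {0<..} x *\<^sub>R (complex_of_real (exp (- e * x)) * cis (t * x)) \<partial>lborel) = 1 / Complex e (- t)"
    and "integrable lborel (\<lambda>x. indicator {0<..} x *\<^sub>R (complex_of_real (exp (- e * x)) * cis (t * x)))"
proof -
  let ?f = "\<lambda>x::real. complex_of_real (exp (- e * x)) * cis (t * x)"
  let ?F = "\<lambda>x::real. - (complex_of_real (exp (- e * x)) * cis (t * x) / Complex e (- t))"
  have nz: "Complex e (- t) \<noteq> 0"
    using assms by (simp add: complex_eq_iff)
  show int: "integrable lborel (\<lambda>x. indicator {0<..} x *\<^sub>R ?f x)"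
    by (rule Bochner_Integration.integrable_bound[OF integrable_exp_half_line[OF assms]])
      (auto simp: indicator_def norm_mult)
  have ein: "einterval 0 \<infinity> = {0::real<..}"
    by (auto simp: einterval_def)
  have der: "(?F has_vector_derivative ?f x) (at x)" for x
  proof -
    have f: "?f x = exp (- (Complex e (- t)) * complex_of_real x)" for x
      by (simp add: cis_conv_exp exp_of_real[symmetric] exp_add[symmetric] Complex_eq algebra_simps)
    have F: "?F = (\<lambda>x. - (exp (- (Complex e (- t)) * complex_of_real x) / Complex e (- t)))"
      by (simp only: f)
    have "((\<lambda>z. - (exp (- (Complex e (- t)) * z) / Complex e (- t))) has_field_derivative
        exp (- (Complex e (- t)) * complex_of_real x)) (at (complex_of_real x))"
      using nz by (auto intro!: derivative_eq_intros simp: field_simps)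
    from has_field_derivative_subset[OF this] show ?thesis
      unfolding F f by (intro has_vector_derivative_real_field) auto
  qed
  have "(LBINT x=0..\<infinity>. ?f x) = 0 - ?F 0"
  proof (rule interval_integral_FTC_integrable)
    show "set_integrable lborel (einterval 0 \<infinity>) ?f"
      unfolding set_integrable_def ein by (rule int)
    show "((?F \<circ> real_of_ereal) \<longlongrightarrow> ?F 0) (at_right 0)"
    proof -
      have "isCont ?F 0" by (rule has_vector_derivative_continuous[OF der])
      then have "(?F \<longlongrightarrow> ?F 0) (at_right 0)"
        by (simp add: isCont_def filterlim_at_split)
      then show ?thesis by (simp add: zero_ereal_def ereal_tendsto_simps)
    qed
    show "((?F \<circ> real_of_ereal) \<longlongrightarrow> 0) (at_left \<infinity>)"
    proof -
      have "filterlim (\<lambda>x. - (e * x)) at_bot at_top"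
        using assms by (intro filterlim_compose[OF filterlim_uminus_at_bot_at_top]
            filterlim_tendsto_pos_mult_at_top[OF tendsto_const _ filterlim_ident]) auto
      then have "((\<lambda>x. exp (- (e * x)) / cmod (Complex e (- t))) \<longlongrightarrow> 0 / cmod (Complex e (- t))) at_top"
        using nz by (intro tendsto_divide filterlim_compose[OF exp_at_bot]) auto
      then have "((\<lambda>x. norm (?F x)) \<longlongrightarrow> 0) at_top"
        by (simp add: norm_divide norm_mult)
      then have "(?F \<longlongrightarrow> 0) at_top"
        by (rule tendsto_norm_zero_cancel)
      then show ?thesis by (simp only: ereal_tendsto_simps)
    qed
    have "continuous_on UNIV ?f"
      by (intro continuous_intros)
    then show "isCont ?f x" for x
      by (simp add: continuous_on_eq_continuous_at)
    show "(?F has_vector_derivative ?f x) (at x)" for x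
      by (rule der)
  qed auto
  then show "(\<integral>x. indicator {0<..} x *\<^sub>R ?f x \<partial>lborel) = 1 / Complex e (- t)"
    by (simp add: interval_lebesgue_integral_def set_lebesgue_integral_def ein)
qed

text \<open>Splitting at 0 and reflecting the negative half turns the integral into 1 / (e - i t) +
  1 / (e + i t). As a function of \<open>t\<close> this is 2 pi times the Poisson kernel, whose
  antiderivative is the source of the arctangents below.\<close>

lemma integral_exp_abs_cis:
  assumes "0 < (e::real)"
  shows "(\<integral>x. complex_of_real (exp (- e * \<bar>x\<bar>)) * cis (t * x) \<partial>lborel) = complex_of_real (2 * e / (e\<^sup>2 + t\<^sup>2))"
proof -
  let ?f = "\<lambda>t x. indicator {0<..} x *\<^sub>R (complex_of_real (exp (- e * x)) * cis (t * x))"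
  note I = integral_exp_cis_half_line[OF assms]
  have "(\<integral>x. complex_of_real (exp (- e * \<bar>x\<bar>)) * cis (t * x) \<partial>lborel) = (\<integral>x. ?f t x + ?f (- t) (- x) \<partial>lborel)"
  proof (rule integral_cong_AE)
    show "AE x in lborel. complex_of_real (exp (- e * \<bar>x\<bar>)) * cis (t * x) = ?f t x + ?f (- t) (- x)"
      using AE_lborel_singleton[of 0] by eventually_elim (auto simp: indicator_def)
  qed auto
  also have "\<dots> = (\<integral>x. ?f t x \<partial>lborel) + (\<integral>x. ?f (- t) (- x) \<partial>lborel)"
    using I(2) integrable_reflect_real[OF I(2)] by (rule Bochner_Integration.integral_add)
  also have "(\<integral>x. ?f (- t) (- x) \<partial>lborel) = (\<integral>x. ?f (- t) x \<partial>lborel)"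
    by (rule integral_reflect_real)
  also have "(\<integral>x. ?f t x \<partial>lborel) + (\<integral>x. ?f (- t) x \<partial>lborel) = 1 / Complex e (- t) + 1 / Complex e t"
    by (simp only: I(1)) simp
  also have "\<dots> = complex_of_real (2 * e / (e\<^sup>2 + t\<^sup>2))"
    using assms by (auto simp: complex_eq_iff Re_divide Im_divide power2_eq_square)
  finally show ?thesis .
qed

subsection \<open>Dirichlet kernels of intervals\<close>

lemma in_Lp_bound:
  assumes "g \<in> borel_measurable lborel" "integrable lborel W" "\<And>x. norm (g x) powr p \<le> W x"
  shows "in_Lp p g"
  unfolding in_Lp_def
proof (intro conjI assms(1))
  show "integrable lborel (\<lambda>x. norm (g x) powr p)"
    by (rule Bochner_Integration.integrable_bound[OF assms(2)])
      (use assms in \<open>auto intro!: always_eventually order_trans[OF assms(3)]\<close>)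
qed

text \<open>Dominated convergence for the p-th powers of the differences; accordingly
  \<open>W\<close> bounds these powers and not the members of the sequence.\<close>

lemma Lp_tendsto_dominated:
  fixes f :: "real \<Rightarrow> 'a::{real_normed_vector, second_countable_topology}"
  assumes "0 < p" and [measurable]: "\<And>n. \<phi> n \<in> borel_measurable lborel" "f \<in> borel_measurable lborel"
    and W: "integrable lborel W" "\<And>n x. norm (\<phi> n x - f x) powr p \<le> W x"
    and lim: "AE x in lborel. (\<lambda>n. \<phi> n x) \<longlonglongrightarrow> f x"
  shows "Lp_tendsto p \<phi> f"
  unfolding Lp_tendsto_def
proof (intro conjI allI)
  show "in_Lp p (\<lambda>x. \<phi> n x - f x)" for n
    by (rule in_Lp_bound[OF _ W]) measurable
  have "(\<lambda>n. \<integral>x. norm (\<phi> n x - f x) powr p \<partial>lborel) \<longlonglongrightarrow> (\<integral>x. 0 \<partial>(lborel :: real measure))"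
  proof (rule integral_dominated_convergence[where w = W])
    show "AE x in lborel. (\<lambda>n. norm (\<phi> n x - f x) powr p) \<longlonglongrightarrow> 0"
      using lim
    proof eventually_elim
      case (elim x)
      then have "(\<lambda>n. norm (\<phi> n x - f x)) \<longlonglongrightarrow> 0"
        by (intro tendsto_norm_zero) (simp add: LIM_zero_iff)
      then show ?case
        using \<open>0 < p\<close> by (intro tendsto_zero_powrI[where b = p]) auto
    qed
  qed (use W in auto)
  then have "(\<lambda>n. \<integral>x. norm (\<phi> n x - f x) powr p \<partial>lborel) \<longlonglongrightarrow> 0"
    by simp
  then show "(\<lambda>n. Lp_norm p (\<lambda>x. \<phi> n x - f x)) \<longlonglongrightarrow> 0"
    unfolding Lp_norm_def using \<open>0 < p\<close> by (intro tendsto_zero_powrI[where b = "1 / p"]) auto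
qed

lemma Lp_tendsto_const:
  fixes f :: "real \<Rightarrow> 'a::{real_normed_vector, second_countable_topology}"
  assumes "f \<in> borel_measurable lborel" "0 < p"
  shows "Lp_tendsto p (\<lambda>n. f) f"
  using assms by (intro Lp_tendsto_dominated[where W = "\<lambda>x. 0"]) auto

text \<open>The inverse Fourier transform of the indicator of (a, b), i.e. (cis (b x) - cis (a x)) /
  (2 pi i x), factored so that its modulus can be read off. At \<open>x = 0\<close> division by zero
  gives 0 instead of the limit (b - a) / (2 pi), which changes only a null set.\<close>

definition dirichlet_kernel :: "real \<Rightarrow> real \<Rightarrow> real \<Rightarrow> complex" where
  "dirichlet_kernel a b x = cis ((a + b) / 2 * x) * complex_of_real (sin ((b - a) / 2 * x) / (pi * x))"

lemma borel_measurable_dirichlet_kernel [measurable]: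
  "dirichlet_kernel a b \<in> borel_measurable borel"
  unfolding dirichlet_kernel_def by measurable

lemma norm_dirichlet_kernel:
  "norm (dirichlet_kernel a b x) = \<bar>sin ((b - a) / 2 * x)\<bar> / (pi * \<bar>x\<bar>)"
  by (simp add: dirichlet_kernel_def norm_mult norm_divide abs_mult)

text \<open>Controls the kernel near the origin: |sin u| \<le> |u| yields |b - a| / (2 pi), which is
  rounded up.\<close>

lemma norm_dirichlet_kernel_le: "norm (dirichlet_kernel a b x) \<le> \<bar>b - a\<bar>"
proof (cases "x = 0")
  case False
  have "\<bar>sin ((b - a) / 2 * x)\<bar> \<le> \<bar>(b - a) / 2 * x\<bar>"
    by (rule abs_sin_x_le_abs_x)
  also have "\<dots> \<le> \<bar>b - a\<bar> * (pi * \<bar>x\<bar>)"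
  proof -
    have "1 / 2 * (\<bar>b - a\<bar> * \<bar>x\<bar>) \<le> pi * (\<bar>b - a\<bar> * \<bar>x\<bar>)"
      using pi_gt3 by (intro mult_right_mono) auto
    then show ?thesis by (simp only: abs_mult abs_divide) (simp add: ac_simps)
  qed
  finally show ?thesis
    using False by (simp add: norm_dirichlet_kernel field_simps)
qed (simp add: norm_dirichlet_kernel)

lemma norm_dirichlet_kernel_le_inverse: "norm (dirichlet_kernel a b x) \<le> 1 / \<bar>x\<bar>"
proof (cases "x = 0")
  case False
  have "\<bar>sin ((b - a) / 2 * x)\<bar> \<le> pi"
    using abs_sin_le_one[of "(b - a) / 2 * x"] pi_gt3 by linarith
  then show ?thesis
    using False by (simp add: norm_dirichlet_kernel field_simps)
qed (simp add: norm_dirichlet_kernel)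

text \<open>A plateau with two power tails, integrable since \<open>1 < p\<close>. The free
  parameters allow two uses: for kernels, with plateau [-1, 1] and tails measured from 0, and for
  smoothed indicators on the Fourier side, with plateau [a - 1, b + 1] and tails measured from
  \<open>b\<close> and \<open>a\<close>.\<close>

lemma integrable_dirichlet_majorant:
  assumes "1 < (p::real)"
  shows "integrable lborel (\<lambda>x. c * indicator {l..u} x
      + d * ((x - u') powr (- p) * indicator {1..} (x - u')
      + (l' - x) powr (- p) * indicator {1..} (l' - x)))"
proof -
  have "integrable lborel (\<lambda>x::real. c * indicator {l..u} x)"
    by (intro integrable_mult_right) (simp add: integrable_indicator_iff emeasure_lborel_Icc_eq)
  moreover have "integrable lborel (\<lambda>x. (x - u') powr (- p) * indicator {1..} (x - u'))"
    using lborel_integrable_real_affine[OF integrable_powr_atLeast_1[OF assms], of 1 "- u'"]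
    by (simp add: algebra_simps)
  moreover have "integrable lborel (\<lambda>x. (l' - x) powr (- p) * indicator {1..} (l' - x))"
    using lborel_integrable_real_affine[OF integrable_powr_atLeast_1[OF assms], of "-1" l'] by simp
  ultimately show ?thesis
    by simp
qed

text \<open>The bound is written as an instance of the integrand in \<open>integrable_dirichlet_majorant\<close>.\<close>

lemma norm_dirichlet_kernel_powr_le:
  assumes "0 < p"
  shows "norm (dirichlet_kernel a b x) powr p \<le> \<bar>b - a\<bar> powr p * indicator {-1..1} x
      + 1 * ((x - 0) powr (- p) * indicator {1..} (x - 0)
      + (0 - x) powr (- p) * indicator {1..} (0 - x))"
    (is "_ \<le> ?A + 1 * (?B + ?C)")
proof (cases "\<bar>x\<bar> \<le> 1")
  case True
  have "norm (dirichlet_kernel a b x) powr p \<le> \<bar>b - a\<bar> powr p"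
    using norm_dirichlet_kernel_le assms by (intro powr_mono2) auto
  then have "norm (dirichlet_kernel a b x) powr p \<le> ?A"
    using True by (auto simp: indicator_def)
  also have "?A \<le> ?A + 1 * (?B + ?C)" by simp
  finally show ?thesis .
next
  case False
  have "norm (dirichlet_kernel a b x) powr p \<le> (1 / \<bar>x\<bar>) powr p"
    using norm_dirichlet_kernel_le_inverse assms by (intro powr_mono2) auto
  also have "\<dots> = \<bar>x\<bar> powr (- p)"
    using False by (simp add: powr_divide powr_minus_divide)
  finally show ?thesis
    using False by (auto simp: indicator_def abs_if split: if_splits)
qed

lemma in_Lp_dirichlet_kernel:
  assumes "1 < p"
  shows "in_Lp p (dirichlet_kernel a b)"
  by (rule in_Lp_bound[OF _ integrable_dirichlet_majorant[OF assms] norm_dirichlet_kernel_powr_le])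
    (use assms in auto)

text \<open>Fubini: both sides are iterated integrals of \<open>exp (- e * \<bar>x\<bar>) * cis (x * (\<eta> - \<xi>)) / (2 * pi)\<close>
  over \<open>x\<close> in the line and \<open>\<eta>\<close> in \<open>[a, b]\<close>.\<close>

lemma fourier_L1_damped_dirichlet_kernel:
  assumes "a \<le> b" "0 < (e::real)"
  shows "fourier_L1 (\<lambda>x. dirichlet_kernel a b x * complex_of_real (exp (- e * \<bar>x\<bar>))) \<xi>
    = complex_of_real ((arctan ((b - \<xi>) / e) - arctan ((a - \<xi>) / e)) / pi)"
proof -
  let ?F = "\<lambda>x \<eta>::real. indicator {a..b} \<eta> *\<^sub>R
      (complex_of_real (exp (- e * \<bar>x\<bar>)) * cis ((\<eta> - \<xi>) * x) / complex_of_real (2 * pi))"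
  \<comment> \<open>The point 0 is left out because the antiderivative in \<open>\<eta>\<close>
    divides by i x.\<close>
  have inner: "(\<integral>\<eta>. ?F x \<eta> \<partial>lborel)
      = dirichlet_kernel a b x * complex_of_real (exp (- e * \<bar>x\<bar>)) * cis (- (x * \<xi>))" if "x \<noteq> 0" for x
  proof -
    let ?c = "complex_of_real (exp (- e * \<bar>x\<bar>)) / complex_of_real (2 * pi)"
    have "(\<integral>\<eta>. indicator {a..b} \<eta> *\<^sub>R (?c * cis ((\<eta> - \<xi>) * x)) \<partial>lborel)
        = ?c * (cis ((b - \<xi>) * x) / (\<i> * x)) - ?c * (cis ((a - \<xi>) * x) / (\<i> * x))"
    proof (rule integral_FTC_Icc[OF assms(1)])
      show "((\<lambda>\<eta>. ?c * (cis ((\<eta> - \<xi>) * x) / (\<i> * x))) has_vector_derivative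
          ?c * cis ((\<eta> - \<xi>) * x)) (at \<eta> within {a..b})" for \<eta>
      proof -
        have "((\<lambda>z. ?c * (exp (\<i> * ((z - \<xi>) * x)) / (\<i> * x))) has_field_derivative
            ?c * exp (\<i> * ((complex_of_real \<eta> - \<xi>) * x))) (at (complex_of_real \<eta>))"
          using that by (auto intro!: derivative_eq_intros simp: field_simps)
        from has_vector_derivative_real_field[OF has_field_derivative_subset[OF this subset_UNIV]]
        show ?thesis by (simp add: cis_conv_exp)
      qed
    qed (intro continuous_intros)
    also have "\<dots> = ?c * cis (- (x * \<xi>)) * ((cis (b * x) - cis (a * x)) / (\<i> * x))"
    proof -
      have "cis ((u - \<xi>) * x) = cis (- (x * \<xi>)) * cis (u * x)" for u
        by (simp add: cis_mult algebra_simps)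
      then show ?thesis
        by (simp add: algebra_simps diff_divide_distrib)
    qed
    also have "cis (b * x) - cis (a * x)
        = cis ((a + b) / 2 * x) * (2 * \<i> * complex_of_real (sin ((b - a) / 2 * x)))"
    proof -
      have "cis (b * x) = cis ((a + b) / 2 * x) * cis ((b - a) / 2 * x)"
        "cis (a * x) = cis ((a + b) / 2 * x) * cis (- ((b - a) / 2 * x))"
        by (simp_all add: cis_mult field_simps)
      moreover have "cis u - cis (- u) = 2 * \<i> * complex_of_real (sin u)" for u
        by (simp add: complex_eq_iff)
      ultimately show ?thesis
        by (metis right_diff_distrib)
    qed
    also have "?c * cis (- (x * \<xi>)) *
        (cis ((a + b) / 2 * x) * (2 * \<i> * complex_of_real (sin ((b - a) / 2 * x))) / (\<i> * x))
        = dirichlet_kernel a b x * complex_of_real (exp (- e * \<bar>x\<bar>)) * cis (- (x * \<xi>))"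
      using that by (simp add: dirichlet_kernel_def field_simps)
    finally show ?thesis
      by (simp add: ac_simps)
  qed
  have "fourier_L1 (\<lambda>x. dirichlet_kernel a b x * complex_of_real (exp (- e * \<bar>x\<bar>))) \<xi>
      = (\<integral>x. (\<integral>\<eta>. ?F x \<eta> \<partial>lborel) \<partial>lborel)"
    unfolding fourier_L1_def
  proof (rule integral_cong_AE)
    show "AE x in lborel. dirichlet_kernel a b x * complex_of_real (exp (- e * \<bar>x\<bar>)) * cis (- (x * \<xi>))
        = (\<integral>\<eta>. ?F x \<eta> \<partial>lborel)"
      using AE_lborel_singleton[of 0] by eventually_elim (rule inner[symmetric])
  qed measurable
  also have "\<dots> = (\<integral>\<eta>. (\<integral>x. ?F x \<eta> \<partial>lborel) \<partial>lborel)"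
  proof (rule lborel_pair.Fubini_integral[symmetric], rule lborel_pair.Fubini_integrable)
    have "(\<integral>\<eta>. norm (?F x \<eta>) \<partial>lborel) = exp (- e * \<bar>x\<bar>) * ((b - a) / (2 * pi))" for x
    proof -
      have "(\<integral>\<eta>. norm (?F x \<eta>) \<partial>lborel)
          = (\<integral>\<eta>. (exp (- e * \<bar>x\<bar>) / (2 * pi)) * indicator {a..b} \<eta> \<partial>lborel)"
        by (intro Bochner_Integration.integral_cong) (auto simp: norm_mult norm_divide indicator_def)
      then show ?thesis using assms by simp
    qed
    then show "integrable lborel (\<lambda>x. \<integral>\<eta>. norm (case_prod ?F (x, \<eta>)) \<partial>lborel)"
      using integrable_exp_abs[OF assms(2)] by simp
    show "AE x in lborel. integrable lborel (\<lambda>\<eta>. case_prod ?F (x, \<eta>))"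
    proof (intro always_eventually allI)
      fix x
      have "integrable lborel (\<lambda>\<eta>::real. indicator {a..b} \<eta> *\<^sub>R (1::real))"
        by (simp add: integrable_indicator_iff emeasure_lborel_Icc_eq)
      then have "integrable lborel (\<lambda>\<eta>. exp (- e * \<bar>x\<bar>) / (2 * pi) * indicator {a..b} \<eta>)"
        by simp
      then show "integrable lborel (\<lambda>\<eta>. case_prod ?F (x, \<eta>))"
        by (rule Bochner_Integration.integrable_bound) (auto simp: norm_mult norm_divide indicator_def)
    qed
  qed measurable
  also have "\<dots> = (\<integral>\<eta>. indicator {a..b} \<eta> *\<^sub>R complex_of_real (e / (e\<^sup>2 + (\<eta> - \<xi>)\<^sup>2) / pi) \<partial>lborel)"
  proof (rule Bochner_Integration.integral_cong[OF refl])
    fix \<eta> :: real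
    have "(\<integral>x. ?F x \<eta> \<partial>lborel) = indicator {a..b} \<eta> *\<^sub>R
        ((\<integral>x. complex_of_real (exp (- e * \<bar>x\<bar>)) * cis ((\<eta> - \<xi>) * x) \<partial>lborel) / complex_of_real (2 * pi))"
      by simp
    also have "(\<integral>x. complex_of_real (exp (- e * \<bar>x\<bar>)) * cis ((\<eta> - \<xi>) * x) \<partial>lborel)
        = complex_of_real (2 * e / (e\<^sup>2 + (\<eta> - \<xi>)\<^sup>2))"
      by (rule integral_exp_abs_cis[OF assms(2)])
    finally show "(\<integral>x. ?F x \<eta> \<partial>lborel)
        = indicator {a..b} \<eta> *\<^sub>R complex_of_real (e / (e\<^sup>2 + (\<eta> - \<xi>)\<^sup>2) / pi)"
      by simp
  qed
  also have "\<dots> = complex_of_real (arctan ((b - \<xi>) / e) / pi) - complex_of_real (arctan ((a - \<xi>) / e) / pi)"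
  proof (rule integral_FTC_Icc[OF assms(1)])
    have nz: "e\<^sup>2 + (\<eta> - \<xi>)\<^sup>2 \<noteq> 0" for \<eta>
      using assms(2) by (auto simp: add_nonneg_eq_0_iff)
    show "((\<lambda>\<eta>. complex_of_real (arctan ((\<eta> - \<xi>) / e) / pi)) has_vector_derivative
        complex_of_real (e / (e\<^sup>2 + (\<eta> - \<xi>)\<^sup>2) / pi)) (at \<eta> within {a..b})" for \<eta>
    proof -
      have "((\<lambda>\<eta>. arctan ((\<eta> - \<xi>) / e) / pi) has_field_derivative
          inverse (1 + ((\<eta> - \<xi>) / e)\<^sup>2) * (1 / e) / pi) (at \<eta> within {a..b})"
        using assms(2) by (auto intro!: derivative_eq_intros)
      moreover have "inverse (1 + ((\<eta> - \<xi>) / e)\<^sup>2) * (1 / e) / pi = e / (e\<^sup>2 + (\<eta> - \<xi>)\<^sup>2) / pi"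
      proof -
        have "1 + ((\<eta> - \<xi>) / e)\<^sup>2 = (e\<^sup>2 + (\<eta> - \<xi>)\<^sup>2) / e\<^sup>2"
          using assms(2) by (simp add: field_simps power_divide)
        then show ?thesis
          using assms(2) by (simp add: power2_eq_square)
      qed
      ultimately show ?thesis
        by (intro has_vector_derivative_of_real) (simp add: has_real_derivative_iff_has_vector_derivative)
    qed
    show "continuous_on {a..b} (\<lambda>\<eta>. complex_of_real (e / (e\<^sup>2 + (\<eta> - \<xi>)\<^sup>2) / pi))"
      using nz by (intro continuous_intros) auto
  qed
  finally show ?thesis
    by (simp add: diff_divide_distrib)
qed

section \<open>Arctangent estimates for the tails of the smoothed indicator\<close>

lemma arctan_diff_le:
  assumes "0 \<le> u" "u \<le> v"
  shows "arctan v - arctan u \<le> (v - u) / (1 + u\<^sup>2)"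
proof (cases "u = v")
  case False
  have pos: "1 + z\<^sup>2 > 0" for z :: real
    by (intro add_pos_nonneg) auto
  obtain z where z: "u < z" "z < v" "arctan v - arctan u = (v - u) * inverse (1 + z\<^sup>2)"
    using MVT2[of u v arctan "\<lambda>z. inverse (1 + z\<^sup>2)"] False assms DERIV_arctan by fastforce
  have "inverse (1 + z\<^sup>2) \<le> inverse (1 + u\<^sup>2)"
    using z assms pos by (intro le_imp_inverse_le add_left_mono power_mono) auto
  then show ?thesis
    using z assms by (simp add: divide_inverse mult_left_mono)
qed auto

text \<open>The factor \<open>n\<close> cancels because \<open>n * t\<close> is at least 1, so that
  1 + (n t)^2 exceeds n t. The resulting decay 1 / t is uniform in \<open>n\<close>, and its square
  is integrable at infinity, as convergence in L^2 requires.\<close>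

lemma arctan_window_le:
  assumes "1 \<le> n" "1 \<le> t" "0 \<le> c"
  shows "arctan (n * (t + c)) - arctan (n * t) \<le> c / t"
proof -
  have "arctan (n * (t + c)) - arctan (n * t) \<le> (n * (t + c) - n * t) / (1 + (n * t)\<^sup>2)"
    using assms by (intro arctan_diff_le mult_left_mono) auto
  also have "\<dots> = (n * c) / (1 + (n * t)\<^sup>2)"
    by (simp add: algebra_simps)
  also have "\<dots> \<le> (n * c) / (n * t)"
  proof (rule divide_left_mono)
    have "(n * t) * 1 \<le> (n * t) * (n * t)"
      using assms mult_mono[of 1 n 1 t] by (intro mult_left_mono) auto
    then show "n * t \<le> 1 + (n * t)\<^sup>2"
      by (simp add: power2_eq_square)
    show "0 < (1 + (n * t)\<^sup>2) * (n * t)"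
      using assms by (intro mult_pos_pos add_pos_nonneg) auto
  qed (use assms in auto)
  also have "\<dots> = c / t" using assms by simp
  finally show ?thesis .
qed

text \<open>The kernel is not in L^1, so it is approximated by \<open>\<phi> n\<close>, its product
  with exp (- |x| / (n + 1)). The transforms \<open>G n\<close> are the Poisson means of the
  indicator, and dominated convergence in L^2 applies on both sides.\<close>

lemma fourier_L2_dirichlet_kernel:
  assumes "a < b"
  shows "fourier_L2 (dirichlet_kernel a b) (indicator {a<..<b})"
proof -
  let ?D = "dirichlet_kernel a b"
  let ?e = "\<lambda>n. 1 / real (Suc n)"
  define \<phi> where "\<phi> n x = ?D x * complex_of_real (exp (- ?e n * \<bar>x\<bar>))" for n x
  define G where "G n \<xi> = (arctan (real (Suc n) * (b - \<xi>)) - arctan (real (Suc n) * (a - \<xi>))) / pi" for n \<xi>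
  have [measurable]: "\<phi> n \<in> borel_measurable borel" for n
    unfolding \<phi>_def by measurable
  have [measurable]: "G n \<in> borel_measurable borel" for n
    unfolding G_def by (intro borel_measurable_continuous_onI continuous_intros) auto
  have damp: "norm (\<phi> n x) \<le> norm (?D x)" for n x
    unfolding \<phi>_def by (simp add: norm_mult mult_left_le)
  note majorant = integrable_dirichlet_majorant[of 2]
  have "in_Lp 1 (\<phi> n)" for n
  proof (rule in_Lp_bound)
    show "integrable lborel (\<lambda>x. \<bar>b - a\<bar> * exp (- ?e n * \<bar>x\<bar>))"
      by (intro integrable_mult_right integrable_exp_abs) auto
    show "norm (\<phi> n x) powr 1 \<le> \<bar>b - a\<bar> * exp (- ?e n * \<bar>x\<bar>)" for x
      unfolding \<phi>_def using norm_dirichlet_kernel_le[of a b x] by (simp add: norm_mult)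
  qed auto
  moreover have "in_Lp 2 (\<phi> n)" for n
  proof (rule in_Lp_bound[OF _ majorant])
    show "norm (\<phi> n x) powr 2 \<le> \<bar>b - a\<bar> powr 2 * indicator {-1..1} x
      + 1 * ((x - 0) powr (- 2) * indicator {1..} (x - 0)
      + (0 - x) powr (- 2) * indicator {1..} (0 - x))" for x
      by (rule order_trans[OF powr_mono2[OF _ _ damp] norm_dirichlet_kernel_powr_le]) auto
  qed auto
  moreover have "Lp_tendsto 2 \<phi> ?D"
  proof (rule Lp_tendsto_dominated[OF _ _ _ majorant])
    show "norm (\<phi> n x - ?D x) powr 2 \<le> \<bar>b - a\<bar> powr 2 * indicator {-1..1} x
      + 1 * ((x - 0) powr (- 2) * indicator {1..} (x - 0)
      + (0 - x) powr (- 2) * indicator {1..} (0 - x))" for n x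
    proof -
      have "\<phi> n x - ?D x = ?D x * complex_of_real (exp (- ?e n * \<bar>x\<bar>) - 1)"
        unfolding \<phi>_def by (simp add: algebra_simps)
      moreover have "\<bar>exp (- ?e n * \<bar>x\<bar>) - 1\<bar> \<le> 1"
      proof -
        have "exp (- ?e n * \<bar>x\<bar>) \<le> 1" by simp
        then show ?thesis using exp_gt_zero[of "- ?e n * \<bar>x\<bar>"] by linarith
      qed
      ultimately have le: "norm (\<phi> n x - ?D x) \<le> norm (?D x)"
        by (simp only: norm_mult norm_of_real mult_left_le norm_ge_zero)
      show ?thesis
        by (rule order_trans[OF powr_mono2[OF _ _ le] norm_dirichlet_kernel_powr_le]) auto
    qed
    show "AE x in lborel. (\<lambda>n. \<phi> n x) \<longlonglongrightarrow> ?D x"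
    proof (intro always_eventually allI)
      fix x :: real
      have "(\<lambda>n. ?D x * complex_of_real (exp (- ?e n * \<bar>x\<bar>)))
          \<longlonglongrightarrow> ?D x * complex_of_real (exp (- 0 * \<bar>x\<bar>))"
        by (intro tendsto_intros LIMSEQ_Suc[OF lim_1_over_n])
      then show "(\<lambda>n. \<phi> n x) \<longlonglongrightarrow> ?D x"
        unfolding \<phi>_def by simp
    qed
  qed auto
  moreover have FT: "fourier_L1 (\<phi> n) = (\<lambda>\<xi>. complex_of_real (G n \<xi>))" for n
    unfolding \<phi>_def G_def using assms
    by (intro ext, subst fourier_L1_damped_dirichlet_kernel) (auto simp: mult.commute)
  moreover have "Lp_tendsto 2 (\<lambda>n \<xi>. complex_of_real (G n \<xi>)) (indicator {a<..<b})"
  proof (rule Lp_tendsto_dominated[OF _ _ _ majorant])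
    have G01: "0 \<le> G n \<xi>" "G n \<xi> \<le> 1" for n \<xi>
    proof -
      show "0 \<le> G n \<xi>"
        unfolding G_def using assms by (simp add: arctan_le_iff mult_left_mono)
      show "G n \<xi> \<le> 1"
        unfolding G_def using arctan_ubound[of "real (Suc n) * (b - \<xi>)"] arctan_lbound[of "real (Suc n) * (a - \<xi>)"]
        by (simp add: field_simps)
    qed
    show "norm (complex_of_real (G n \<xi>) - indicator {a<..<b} \<xi>) powr 2
      \<le> 1 * indicator {a - 1..b + 1} \<xi>
      + (b - a)\<^sup>2 * ((\<xi> - b) powr (- 2) * indicator {1..} (\<xi> - b)
      + (a - \<xi>) powr (- 2) * indicator {1..} (a - \<xi>))" for n \<xi>
    proof (cases "\<xi> \<in> {a - 1..b + 1}")
      case True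
      have "complex_of_real (G n \<xi>) - indicator {a<..<b} \<xi> = complex_of_real (G n \<xi> - indicator {a<..<b} \<xi>)"
        by (simp add: indicator_def)
      moreover have "\<bar>G n \<xi> - indicator {a<..<b} \<xi>\<bar> \<le> 1"
        using G01[of n \<xi>] by (auto simp: indicator_def)
      ultimately have "norm (complex_of_real (G n \<xi>) - indicator {a<..<b} \<xi>) \<le> 1"
        by (simp only: norm_of_real)
      from powr_mono2[of 2, OF _ _ this] have "norm (complex_of_real (G n \<xi>) - indicator {a<..<b} \<xi>) powr 2 \<le> 1"
        by simp
      then show ?thesis
        using True by (simp add: add_increasing2)
    next
      case False
      \<comment> \<open>\<open>t\<close> is the distance from \<open>\<xi>\<close> to the interval;
        the oddness of \<open>arctan\<close> makes the two sides alike.\<close>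
      define t where "t = (if \<xi> > b + 1 then \<xi> - b else a - \<xi>)"
      have t: "1 < t" using False by (auto simp: t_def)
      have "G n \<xi> \<le> (b - a) / t"
      proof -
        have "pi * G n \<xi> = arctan (real (Suc n) * (t + (b - a))) - arctan (real (Suc n) * t)"
        proof (cases "\<xi> > b + 1")
          case True
          have "real (Suc n) * (b - \<xi>) = - (real (Suc n) * t)"
            "real (Suc n) * (a - \<xi>) = - (real (Suc n) * (t + (b - a)))"
            using True by (auto simp: t_def algebra_simps)
          then show ?thesis
            by (simp only: G_def arctan_minus) simp
        next
          case False
          then have "b - \<xi> = t + (b - a)" "a - \<xi> = t"
            by (auto simp: t_def)
          then show ?thesis by (simp only: G_def) simp
        qed
        also have "\<dots> \<le> (b - a) / t"
          using t assms by (intro arctan_window_le) auto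
        finally have "pi * G n \<xi> \<le> (b - a) / t" .
        moreover have "1 * G n \<xi> \<le> pi * G n \<xi>"
          using G01(1)[of n \<xi>] pi_gt3 by (intro mult_right_mono) auto
        ultimately show ?thesis by simp
      qed
      then have "norm (complex_of_real (G n \<xi>)) \<le> (b - a) / t"
        using G01(1)[of n \<xi>] by simp
      from powr_mono2[of 2, OF _ _ this] have "norm (complex_of_real (G n \<xi>)) powr 2 \<le> ((b - a) / t) powr 2"
        by simp
      also have "\<dots> = (b - a)\<^sup>2 * t powr (- 2)"
        using t assms by (simp add: powr_divide powr_minus_divide)
      finally show ?thesis
        using False t assms by (auto simp: t_def indicator_def split: if_splits)
    qed
    \<comment> \<open>At \<open>a\<close> and \<open>b\<close> the limit is 1 / 2, which is not the
      value of the indicator, so these two points are discarded as a null set.\<close>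
    show "AE \<xi> in lborel. (\<lambda>n. complex_of_real (G n \<xi>)) \<longlonglongrightarrow> indicator {a<..<b} \<xi>"
      using AE_lborel_singleton[of a] AE_lborel_singleton[of b]
    proof eventually_elim
      case (elim \<xi>)
      have top: "filterlim (\<lambda>n. real (Suc n)) at_top sequentially"
        by (rule filterlim_compose[OF filterlim_real_sequentially filterlim_Suc])
      have lim_pos: "(\<lambda>n. arctan (real (Suc n) * y)) \<longlonglongrightarrow> pi / 2" if "0 < y" for y
        by (rule filterlim_compose[OF tendsto_arctan_at_top])
          (rule filterlim_at_top_mult_tendsto_pos[OF tendsto_const that top])
      have lim: "(\<lambda>n. arctan (real (Suc n) * y)) \<longlonglongrightarrow> sgn y * (pi / 2)" if "y \<noteq> 0" for y
      proof (cases "0 < y")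
        case False
        then have "(\<lambda>n. - arctan (real (Suc n) * (- y))) \<longlonglongrightarrow> - (pi / 2)"
          using that by (intro tendsto_minus lim_pos) auto
        then show ?thesis using False that by (simp add: arctan_minus)
      qed (use lim_pos in simp)
      have "(\<lambda>n. complex_of_real (G n \<xi>)) \<longlonglongrightarrow>
          complex_of_real ((sgn (b - \<xi>) * (pi / 2) - sgn (a - \<xi>) * (pi / 2)) / pi)"
        unfolding G_def using elim by (intro tendsto_intros lim) auto
      also have "complex_of_real ((sgn (b - \<xi>) * (pi / 2) - sgn (a - \<xi>) * (pi / 2)) / pi)
          = indicator {a<..<b} \<xi>"
        using elim assms by (auto simp: indicator_def sgn_if)
      finally show ?case .
    qed
  qed auto
  moreover have "in_Lp 2 (indicator {a<..<b} :: real \<Rightarrow> complex)"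
    by (rule in_Lp_bound[where W = "indicator {a<..<b}"])
      (use assms in \<open>auto simp: integrable_indicator_iff emeasure_lborel_Ioo indicator_def\<close>)
  moreover have "in_Lp 2 ?D"
    by (rule in_Lp_dirichlet_kernel) simp
  ultimately show ?thesis
    unfolding fourier_L2_def by (auto intro!: exI[of _ \<phi>])
qed

text \<open>On the Fourier side the indicator of the larger interval is cut down to that of the
  smaller one. Both kernels lie in L^2 and L^p, so constant sequences witness the extension by
  density.\<close>

lemma proj_Lp_dirichlet_kernel:
  assumes "1 < p" "c \<le> a" "a < b" "b \<le> d"
  shows "proj_Lp p {a<..<b} (dirichlet_kernel c d) (dirichlet_kernel a b)"
proof -
  have "(\<lambda>\<xi>. indicator {a<..<b} \<xi> * (indicator {c<..<d} \<xi> :: complex)) = indicator {a<..<b}"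
    using assms by (auto simp: indicator_def fun_eq_iff)
  then have "proj_L2 {a<..<b} (dirichlet_kernel c d) (dirichlet_kernel a b)"
    unfolding proj_L2_def using assms fourier_L2_dirichlet_kernel[of c d] fourier_L2_dirichlet_kernel[of a b]
    by (intro exI[of _ "indicator {c<..<d}"]) auto
  then show ?thesis
    unfolding proj_Lp_def using assms
    by (intro conjI in_Lp_dirichlet_kernel exI[of _ "\<lambda>n. dirichlet_kernel c d"]
        exI[of _ "\<lambda>n. dirichlet_kernel a b"] allI Lp_tendsto_const) auto
qed

subsection \<open>Counting long gaps\<close>

text \<open>Since sin^2 (l x / 2) = (1 - cos (l x)) / 2, the window of length 4 / \<delta>
  contributes 2 / \<delta>, and the two boundary terms cost at most 1 / (2 \<delta>) each because
  \<open>\<delta> \<le> l\<close>. One window thus serves all gaps of length at least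
  \<open>\<delta>\<close>.\<close>

lemma integral_sin_squared_window:
  fixes \<delta> l :: real
  assumes "0 < \<delta>" "\<delta> \<le> l"
  shows "1 / \<delta> \<le> (\<integral>x. (sin (l / 2 * x))\<^sup>2 * indicator {4 / \<delta>..8 / \<delta>} x \<partial>lborel)"
proof -
  let ?F = "\<lambda>x. x / 2 - sin (l * x) / (2 * l)"
  have l: "0 < l" using assms by linarith
  have "(\<integral>x. (sin (l / 2 * x))\<^sup>2 * indicator {4 / \<delta>..8 / \<delta>} x \<partial>lborel) = ?F (8 / \<delta>) - ?F (4 / \<delta>)"
  proof (rule integral_FTC_Icc_real)
    show "(?F has_real_derivative (sin (l / 2 * x))\<^sup>2) (at x)" for x
    proof -
      have "(?F has_real_derivative 1 / 2 - cos (l * x) * l / (2 * l)) (at x)"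
        using l by (auto intro!: derivative_eq_intros)
      also have "1 / 2 - cos (l * x) * l / (2 * l) = (sin (l / 2 * x))\<^sup>2"
        using l cos_double_sin[of "l / 2 * x"] by (simp add: field_simps)
      finally show ?thesis .
    qed
  qed (use assms in \<open>auto intro!: continuous_intros divide_right_mono\<close>)
  moreover have "sin (l * y) / (2 * l) \<le> 1 / (2 * \<delta>)" "- (1 / (2 * \<delta>)) \<le> sin (l * y) / (2 * l)" for y
  proof -
    have "\<bar>sin (l * y) / (2 * l)\<bar> \<le> 1 / (2 * l)"
      using l by (simp add: abs_divide divide_right_mono)
    also have "\<dots> \<le> 1 / (2 * \<delta>)"
      using assms l by (simp add: frac_le)
    finally show "sin (l * y) / (2 * l) \<le> 1 / (2 * \<delta>)" "- (1 / (2 * \<delta>)) \<le> sin (l * y) / (2 * l)"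
      unfolding abs_le_iff by linarith+
  qed
  from this(1)[of "8 / \<delta>"] this(2)[of "4 / \<delta>"]
  have "8 / \<delta> / 2 - 4 / \<delta> / 2 - 2 * (1 / (2 * \<delta>)) \<le> ?F (8 / \<delta>) - ?F (4 / \<delta>)"
    by linarith
  moreover have "8 / \<delta> / 2 - 4 / \<delta> / 2 - 2 * (1 / (2 * \<delta>)) = 1 / \<delta>"
    using assms by (simp add: field_simps)
  ultimately show ?thesis by simp
qed

text \<open>The containment in \<open>{c..d}\<close> excludes unbounded components, on which
  \<open>measure\<close> has the default value 0. With \<open>\<delta> = 0\<close> all gaps inside
  \<open>{c..d}\<close> are meant.\<close>

definition gaps :: "real set \<Rightarrow> real \<Rightarrow> real \<Rightarrow> real \<Rightarrow> real set set" where
  "gaps E c d \<delta> = {I \<in> components (- E). I \<subseteq> {c..d} \<and> \<delta> \<le> measure lborel I}"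

section \<open>Bounded components as open intervals\<close>

lemma open_connected_bounded_real:
  fixes I :: "real set"
  assumes "open I" "connected I" "I \<noteq> {}" "I \<subseteq> {c..d}"
  obtains a b where "a < b" "c \<le> a" "b \<le> d" "I = {a<..<b}"
proof -
  have bdd: "bdd_below I" "bdd_above I"
    using assms(4) by (auto intro: bdd_below_mono bdd_above_mono)
  have eq: "I = {Inf I<..<Sup I}"
  proof (intro set_eqI iffI)
    fix x assume x: "x \<in> I"
    obtain e where e: "e > 0" "cball x e \<subseteq> I"
      using assms(1) x open_contains_cball by blast
    then have "x - e \<in> I" "x + e \<in> I"
      by (auto simp: subset_iff dist_real_def)
    then have "Inf I \<le> x - e" "x + e \<le> Sup I"
      using bdd by (auto intro: cInf_lower cSup_upper)
    then show "x \<in> {Inf I<..<Sup I}"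
      using e by auto
  next
    fix x assume "x \<in> {Inf I<..<Sup I}"
    then obtain y z where "y \<in> I" "y < x" "z \<in> I" "x < z"
      using cInf_less_iff[OF assms(3) bdd(1)] less_cSup_iff[OF assms(3) bdd(2)] by auto
    then show "x \<in> I"
      using assms(2) unfolding is_interval_connected_1[symmetric] is_interval_1
      by (meson less_imp_le)
  qed
  moreover have "Inf I < Sup I"
    using eq assms(3) by (metis greaterThanLessThan_empty_iff not_less)
  moreover have "c \<le> Inf I" "Sup I \<le> d"
    using assms(3,4) by (auto intro!: cInf_greatest cSup_least)
  ultimately show ?thesis using that by blast
qed

lemma component_real_cases:
  fixes E :: "real set"
  assumes "closed E" "I \<in> components (- E)" "I \<subseteq> {c..d}"
  obtains a b where "a < b" "c \<le> a" "b \<le> d" "I = {a<..<b}"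
  using assms in_components_connected in_components_nonempty open_components[of "- E" I]
    open_connected_bounded_real by (metis open_Compl)

text \<open>As \<open>p / 2 - 1\<close> is negative, its power is smallest at the upper bound
  \<open>N\<close>. This replaces the power p / 2 by a lower bound linear in \<open>G\<close>, whose
  integral over the window is under control.\<close>

lemma powr_half_ge_linear:
  assumes "p < 2" "0 \<le> G" "G \<le> (N::real)"
  shows "N powr (p / 2 - 1) * G \<le> G powr (p / 2)"
proof (cases "G = 0")
  case False
  then have "N powr (p / 2 - 1) * G \<le> G powr (p / 2 - 1) * G"
    using assms by (intro mult_right_mono powr_mono2') auto
  also have "\<dots> = G powr (p / 2)"
    using False assms by (simp add: powr_diff)
  finally show ?thesis .
qed simp

text \<open>The constant is (8 pi A)^2, where \<open>A\<close> bounds the norm of the square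
  function of the test kernel and depends on neither \<open>\<delta>\<close> nor \<open>F\<close>.
  Finite subfamilies are counted because the finiteness of \<open>gaps E c d \<delta>\<close> is
  later deduced from this very bound.\<close>

lemma LP_p_imp_card_gaps_le:
  assumes p: "1 < p" "p < 2" and LP: "LP_p p E" and cd: "c < d"
  obtains K where "0 \<le> K"
    "\<And>\<delta> F. 0 < \<delta> \<Longrightarrow> finite F \<Longrightarrow> F \<subseteq> gaps E c d \<delta> \<Longrightarrow> real (card F) \<le> K * \<delta> powr (- (2 * (p - 1) / p))"
proof -
  let ?f = "dirichlet_kernel c d"
  have f: "in_Lp p ?f"
    by (rule in_Lp_dirichlet_kernel[OF p(1)])
  obtain c2 where c2: "0 < c2" and ex: "\<And>I. I \<in> components (- E) \<Longrightarrow> \<exists>g. proj_Lp p I ?f g"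
    and bound: "\<And>h. (\<And>I. I \<in> components (- E) \<Longrightarrow> proj_Lp p I ?f (h I)) \<Longrightarrow>
           (AE x in lborel. (\<lambda>I. (cmod (h I x))\<^sup>2) summable_on components (- E)) \<and>
           in_Lp p (square_function E h) \<and>
           Lp_norm p (square_function E h) \<le> c2 * Lp_norm p ?f"
    using LP f unfolding LP_p_def by blast
  have E: "closed E" using LP unfolding LP_p_def by blast
  \<comment> \<open>Gaps inside \<open>{c..d}\<close> get the explicit kernel. The other components
    get any representative supplied by the existence clause; their terms can only enlarge the square
    function.\<close>
  define h where "h I = (if I \<subseteq> {c..d} then dirichlet_kernel (Inf I) (Sup I) else SOME g. proj_Lp p I ?f g)" for I
  have "proj_Lp p I ?f (h I)" if I: "I \<in> components (- E)" for I
  proof (cases "I \<subseteq> {c..d}")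
    case True
    obtain a b where ab: "a < b" "c \<le> a" "b \<le> d" "I = {a<..<b}"
      using component_real_cases[OF E I True] .
    then have "h I = dirichlet_kernel a b"
      using True by (simp add: h_def)
    then show ?thesis
      using proj_Lp_dirichlet_kernel[of p c a b d] ab p by simp
  next
    case False
    then show ?thesis
      using someI_ex[OF ex[OF I]] by (simp add: h_def)
  qed
  from bound[OF this] have summ: "AE x in lborel. (\<lambda>I. (cmod (h I x))\<^sup>2) summable_on components (- E)"
    and S: "in_Lp p (square_function E h)"
    and S_le: "Lp_norm p (square_function E h) \<le> c2 * Lp_norm p ?f"
    by blast+
  define A where "A = c2 * Lp_norm p ?f"
  have A: "0 \<le> A"
    using c2 by (simp add: A_def Lp_norm_def)
  let ?S = "square_function E h"
  have S_int: "(\<integral>x. norm (?S x) powr p \<partial>lborel) \<le> A powr p"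
  proof -
    have "(\<integral>x. norm (?S x) powr p \<partial>lborel) = Lp_norm p ?S powr p"
      unfolding Lp_norm_def using p by (simp add: powr_powr integral_nonneg)
    also have "\<dots> \<le> A powr p"
      using S_le p by (intro powr_mono2) (auto simp: A_def Lp_norm_def)
    finally show ?thesis .
  qed
  have main: "real (card F) \<le> (8 * pi * A)\<^sup>2 * \<delta> powr (- (2 * (p - 1) / p))"
    if \<delta>: "0 < \<delta>" and F: "finite F" "F \<subseteq> gaps E c d \<delta>" for \<delta> F
  proof (cases "F = {}")
    case False
    define N where "N = real (card F)"
    have N: "0 < N" using False F by (simp add: N_def card_gt_0_iff)
    define G where "G x = (\<Sum>I\<in>F. (sin ((Sup I - Inf I) / 2 * x))\<^sup>2)" for x
    have G: "0 \<le> G x" "G x \<le> N" for x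
    proof -
      show "0 \<le> G x" unfolding G_def by (intro sum_nonneg) auto
      have "G x \<le> (\<Sum>I\<in>F. 1)"
        unfolding G_def by (intro sum_mono) (simp add: abs_square_le_1)
      then show "G x \<le> N" by (simp add: N_def)
    qed
    have len: "\<delta> \<le> Sup I - Inf I" if "I \<in> F" for I
    proof -
      have I: "I \<in> components (- E)" "I \<subseteq> {c..d}" "\<delta> \<le> measure lborel I"
        using F(2) that by (auto simp: gaps_def)
      obtain a b where "a < b" "I = {a<..<b}"
        using component_real_cases[OF E I(1,2)] .
      then show ?thesis using I(3) by simp
    qed
    let ?J = "{4 / \<delta>..8 / \<delta>}"
    have sin_int: "integrable lborel (\<lambda>x. (sin (l / 2 * x))\<^sup>2 * indicator ?J x)" for l :: real
      using borel_integrable_compact[of ?J "\<lambda>x. (sin (l / 2 * x))\<^sup>2"]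
      by (simp add: mult.commute continuous_intros)
    have G_split: "G x * indicator ?J x = (\<Sum>I\<in>F. (sin ((Sup I - Inf I) / 2 * x))\<^sup>2 * indicator ?J x)" for x
      by (simp add: G_def sum_distrib_right)
    have G_integrable: "integrable lborel (\<lambda>x. G x * indicator ?J x)"
      unfolding G_split by (intro Bochner_Integration.integrable_sum sin_int)
    have "N / \<delta> = (\<Sum>I\<in>F. 1 / \<delta>)"
      by (simp add: N_def)
    also have "\<dots> \<le> (\<Sum>I\<in>F. \<integral>x. (sin ((Sup I - Inf I) / 2 * x))\<^sup>2 * indicator ?J x \<partial>lborel)"
      by (intro sum_mono integral_sin_squared_window \<delta> len)
    also have "\<dots> = (\<integral>x. G x * indicator ?J x \<partial>lborel)"
      unfolding G_split by (rule Bochner_Integration.integral_sum[symmetric]) (rule sin_int)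
    finally have G_int: "N / \<delta> \<le> (\<integral>x. G x * indicator ?J x \<partial>lborel)" .
    \<comment> \<open>On \<open>?J\<close> the factor 1 / (pi x) is at least \<delta> / (8 pi),
      which gives the first power; the second comes from the linear lower bound for
      \<open>G x powr (p / 2)\<close>.\<close>
    define k where "k = (\<delta> / (8 * pi)) powr p * N powr (p / 2 - 1)"
    have k: "0 \<le> k" by (simp add: k_def)
    have lower: "AE x in lborel. k * (G x * indicator ?J x) \<le> norm (?S x) powr p"
      using summ
    proof eventually_elim
      case (elim x)
      show ?case
      proof (cases "x \<in> ?J")
        case True
        have x: "0 < x" "x \<le> 8 / \<delta>"
          using True \<delta> by (auto intro: less_le_trans[of 0 "4 / \<delta>" x])
        have "G x * (\<delta> / (8 * pi))\<^sup>2 \<le> G x * (1 / (pi * x))\<^sup>2"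
        proof (intro mult_left_mono power_mono G)
          have "pi * x * \<delta> \<le> pi * (8 / \<delta>) * \<delta>"
            using x \<delta> by (intro mult_right_mono mult_left_mono) auto
          then show "\<delta> / (8 * pi) \<le> 1 / (pi * x)"
            using x \<delta> by (simp add: field_simps)
        qed (use \<delta> in auto)
        also have "\<dots> = (\<Sum>I\<in>F. (cmod (h I x))\<^sup>2)"
        proof -
          have "(cmod (h I x))\<^sup>2 = (sin ((Sup I - Inf I) / 2 * x))\<^sup>2 * (1 / (pi * x))\<^sup>2" if "I \<in> F" for I
            using F(2) that by (auto simp: h_def gaps_def norm_dirichlet_kernel power_divide power_mult_distrib)
          then show ?thesis by (simp add: G_def sum_distrib_right)
        qed
        \<comment> \<open>Summability matters here: without it the infinite sum would have the
          default value 0.\<close>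
        also have "\<dots> \<le> (\<Sum>\<^sub>\<infinity>I\<in>components (- E). (cmod (h I x))\<^sup>2)"
          using F by (intro finite_sum_le_infsum elim) (auto simp: gaps_def)
        finally have "sqrt (G x * (\<delta> / (8 * pi))\<^sup>2) \<le> ?S x"
          unfolding square_function_def by (rule real_sqrt_le_mono)
        then have S_ge: "sqrt (G x) * (\<delta> / (8 * pi)) \<le> ?S x"
          using \<delta> by (simp add: real_sqrt_mult)
        have "k * (G x * indicator ?J x) = (\<delta> / (8 * pi)) powr p * (N powr (p / 2 - 1) * G x)"
          using True by (simp add: k_def)
        also have "\<dots> \<le> (\<delta> / (8 * pi)) powr p * G x powr (p / 2)"
          using powr_half_ge_linear[OF p(2) G] by (intro mult_left_mono) auto
        also have "\<dots> = (sqrt (G x) * (\<delta> / (8 * pi))) powr p"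
        proof -
          have "sqrt (G x) powr p = G x powr (p / 2)"
            using G[of x] by (simp add: powr_half_sqrt[symmetric] powr_powr)
          then show ?thesis
            using \<delta> G[of x] by (simp add: powr_mult powr_divide)
        qed
        also have "\<dots> \<le> norm (?S x) powr p"
          using S_ge \<delta> G p by (intro powr_mono2) auto
        finally show ?thesis .
      qed simp
    qed
    have "k * (N / \<delta>) \<le> k * (\<integral>x. G x * indicator ?J x \<partial>lborel)"
      by (rule mult_left_mono[OF G_int k])
    also have "\<dots> = (\<integral>x. k * (G x * indicator ?J x) \<partial>lborel)"
      by simp
    also have "\<dots> \<le> (\<integral>x. norm (?S x) powr p \<partial>lborel)"
      using S unfolding in_Lp_def by (intro integral_mono_AE lower integrable_mult_right G_integrable) auto
    also have "\<dots> \<le> A powr p" by (rule S_int)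
    finally have "k * (N / \<delta>) \<le> A powr p" .
    moreover have "k * (N / \<delta>) = N powr (p / 2) * (\<delta> powr (p - 1) / (8 * pi) powr p)"
    proof -
      have e: "N powr (p / 2 - 1) = N powr (p / 2) / N"
        using N by (simp add: powr_diff)
      show ?thesis
        unfolding k_def e using N \<delta> by (simp add: powr_divide powr_diff field_simps)
    qed
    ultimately have le: "N powr (p / 2) * (\<delta> powr (p - 1) / (8 * pi) powr p) \<le> A powr p"
      by simp
    have "N powr (p / 2) \<le> (8 * pi * A) powr p * \<delta> powr (- (p - 1))"
    proof -
      define X where "X = \<delta> powr (p - 1)"
      define Y where "Y = (8 * pi) powr p"
      have dX: "\<delta> powr (- (p - 1)) = inverse X"
        unfolding X_def by (rule powr_minus)
      have AY: "(8 * pi * A) powr p = Y * A powr p"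
        unfolding Y_def using A by (intro powr_mult)
      have "0 < X" "0 < Y" using \<delta> by (auto simp: X_def Y_def)
      moreover have "N powr (p / 2) * (X / Y) \<le> A powr p"
        using le unfolding X_def Y_def .
      ultimately show ?thesis
        unfolding dX AY by (simp add: field_simps)
    qed
    \<comment> \<open>The power 2 / p isolates \<open>N\<close> and turns the exponent -(p - 1) of
      \<open>\<delta>\<close> into -2 (p - 1) / p.\<close>
    then have "(N powr (p / 2)) powr (2 / p) \<le> ((8 * pi * A) powr p * \<delta> powr (- (p - 1))) powr (2 / p)"
      using p by (intro powr_mono2) auto
    moreover have "(N powr (p / 2)) powr (2 / p) = N"
      using p N by (simp add: powr_powr)
    moreover have "((8 * pi * A) powr p * \<delta> powr (- (p - 1))) powr (2 / p)
        = (8 * pi * A)\<^sup>2 * \<delta> powr (- (2 * (p - 1) / p))"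
    proof -
      have "((8 * pi * A) powr p) powr (2 / p) = (8 * pi * A)\<^sup>2"
        using p A by (simp add: powr_powr)
      moreover have "(\<delta> powr (- (p - 1))) powr (2 / p) = \<delta> powr (- (2 * (p - 1) / p))"
        unfolding powr_powr using p by (intro arg_cong2[where f = "(powr)"]) (auto simp: field_simps)
      moreover have "((8 * pi * A) powr p * \<delta> powr (- (p - 1))) powr (2 / p)
          = ((8 * pi * A) powr p) powr (2 / p) * (\<delta> powr (- (p - 1))) powr (2 / p)"
        by (rule powr_mult)
      ultimately show ?thesis by simp
    qed
    ultimately show ?thesis by (simp add: N_def)
  qed simp
  show ?thesis
    by (rule that[OF _ main]) auto
qed

subsection \<open>Hausdorff premeasures\<close>

text \<open>Choose a cover of \<open>A n\<close> with sum below e / 2^(n + 1) and merge these covers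
  into a single sequence by the pairing function.\<close>

lemma hausdorff_premeasure_countable_Union_eq_0:
  assumes "\<And>n::nat. hausdorff_premeasure s \<delta> (A n) = 0"
  shows "hausdorff_premeasure s \<delta> (\<Union>n. A n) = 0"
proof -
  have "hausdorff_premeasure s \<delta> (\<Union>n. A n) \<le> 0 + ennreal e" if "0 < e" for e
  proof -
    have "\<exists>U. A n \<subseteq> (\<Union>i::nat. U i) \<and> (\<forall>i. bounded (U i) \<and> diameter (U i) \<le> \<delta>) \<and>
        (\<Sum>i. ennreal (diameter (U i) powr s)) < ennreal (e * (1 / 2) ^ Suc n)" for n
    proof -
      have "hausdorff_premeasure s \<delta> (A n) < ennreal (e * (1 / 2) ^ Suc n)"
        using assms that by simp
      then show ?thesis
        unfolding hausdorff_premeasure_def by (subst (asm) INF_less_iff) auto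
    qed
    then obtain U where U: "\<And>n. A n \<subseteq> (\<Union>i::nat. U n i)"
      "\<And>n i. bounded (U n i)" "\<And>n i. diameter (U n i) \<le> \<delta>"
      "\<And>n. (\<Sum>i. ennreal (diameter (U n i) powr s)) < ennreal (e * (1 / 2) ^ Suc n)"
      by metis
    let ?V = "\<lambda>k. U (fst (prod_decode k)) (snd (prod_decode k))"
    have "x \<in> (\<Union>k. ?V k)" if x: "x \<in> A n" for x n
    proof -
      obtain i where "x \<in> U n i" using U(1) x by blast
      then have "x \<in> ?V (prod_encode (n, i))" by simp
      then show ?thesis by blast
    qed
    then have "(\<Union>n. A n) \<subseteq> (\<Union>k. ?V k)"
      by (rule UN_least[OF subsetI])
    then have "hausdorff_premeasure s \<delta> (\<Union>n. A n) \<le> (\<Sum>k. ennreal (diameter (?V k) powr s))"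
      unfolding hausdorff_premeasure_def by (intro INF_lower CollectI conjI allI U)
    also have "\<dots> = (\<Sum>n. \<Sum>i. ennreal (diameter (U n i) powr s))"
      using suminf_ennreal_2dimen[where f = "\<lambda>z. ennreal (diameter (U (fst z) (snd z)) powr s)", OF refl]
      by simp
    also have "\<dots> \<le> (\<Sum>n. ennreal (e * (1 / 2) ^ Suc n))"
      using U(4) by (intro suminf_le less_imp_le) auto
    also have "\<dots> = ennreal (e * 1)"
      using that by (intro suminf_ennreal_eq sums_mult power_half_series) auto
    finally show ?thesis by simp
  qed
  then have "hausdorff_premeasure s \<delta> (\<Union>n. A n) \<le> 0"
    by (rule ennreal_le_epsilon)
  then show ?thesis by (simp only: le_zero_eq)
qed

text \<open>The finite cover is padded to a sequence by empty sets, whose terms vanish because they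
  have diameter 0 and \<open>0 powr s = 0\<close>.\<close>

lemma hausdorff_premeasure_le_finite_cover:
  fixes U :: "nat \<Rightarrow> 'a::metric_space set"
  assumes "finite T" "A \<subseteq> (\<Union>i\<in>T. U i)" "\<And>i. i \<in> T \<Longrightarrow> bounded (U i)"
    and diam: "\<And>i. i \<in> T \<Longrightarrow> diameter (U i) \<le> \<eta>" and "0 \<le> \<eta>" "\<eta> \<le> \<delta>" "0 \<le> s"
  shows "hausdorff_premeasure s \<delta> A \<le> ennreal (card T * \<eta> powr s)"
proof -
  let ?V = "\<lambda>i. if i \<in> T then U i else {}"
  have "hausdorff_premeasure s \<delta> A \<le> (\<Sum>i. ennreal (diameter (?V i) powr s))"
    unfolding hausdorff_premeasure_def
  proof (rule INF_lower, intro CollectI conjI allI)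
    have "(\<Union>i\<in>T. U i) \<subseteq> (\<Union>i. ?V i)" by (auto split: if_splits)
    then show "A \<subseteq> (\<Union>i. ?V i)" using assms(2) by (rule order_trans[rotated])
    show "diameter (?V i) \<le> \<delta>" for i
      using diam[of i] assms(5,6) by auto
  qed (use assms(3) in auto)
  also have "\<dots> = (\<Sum>i\<in>T. ennreal (diameter (?V i) powr s))"
    by (rule suminf_finite) (use assms(1) in auto)
  also have "\<dots> \<le> (\<Sum>i\<in>T. ennreal (\<eta> powr s))"
  proof (intro sum_mono ennreal_leI powr_mono2)
    fix i assume "i \<in> T"
    then show "0 \<le> diameter (?V i)" "diameter (?V i) \<le> \<eta>"
      using assms(3) diam diameter_ge_0 by auto
  qed (use assms in auto)
  also have "\<dots> = ennreal (card T * \<eta> powr s)"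
    by (simp add: ennreal_mult' ennreal_of_nat_eq_real_of_nat)
  finally show ?thesis .
qed

subsection \<open>Covering by a grid\<close>

text \<open>A connected set that meets [c, d] and leaves it would contain \<open>c\<close> or
  \<open>d\<close>, but these lie in \<open>E\<close>.\<close>

lemma component_subset_interval:
  fixes E :: "real set"
  assumes "I \<in> components (- E)" "c \<in> E" "d \<in> E" "y \<in> I" "c \<le> y" "y \<le> d"
  shows "I \<subseteq> {c..d}"
proof
  fix z assume z: "z \<in> I"
  have cd: "c \<notin> I" "d \<notin> I"
    using in_components_subset[OF assms(1)] assms(2,3) by auto
  have between: "w \<in> I" if "u \<in> I" "v \<in> I" "u \<le> w" "w \<le> v" for u v w
  proof -
    have "is_interval I"
      using in_components_connected[OF assms(1)] by (simp only: is_interval_connected_1)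
    then show ?thesis
      using that unfolding is_interval_1 by blast
  qed
  have "\<not> z < c" "\<not> d < z"
    using between[OF z assms(4), of c] between[OF assms(4) z, of d] cd assms(5,6) by linarith+
  then show "z \<in> {c..d}" by simp
qed

text \<open>At most K (D j / 2)^(-\<alpha>) gaps have length in [D j / 2, D j), so their total
  length is at most K 2^\<alpha> (D j)^(1 - \<alpha>). Over \<open>j\<close> these bounds form a
  geometric series of ratio 2^(\<alpha> - 1), which is below 1 because
  \<open>\<alpha> < 1\<close>.\<close>

lemma countable_cover_small_gaps:
  fixes E :: "real set"
  assumes E: "closed E" and cd: "c \<in> E" "d \<in> E"
    and \<alpha>: "0 < \<alpha>" "\<alpha> < 1" and K: "0 \<le> K"
    and fin: "\<And>\<delta>. 0 < \<delta> \<Longrightarrow> finite (gaps E c d \<delta>)"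
    and card: "\<And>\<delta>. 0 < \<delta> \<Longrightarrow> real (card (gaps E c d \<delta>)) \<le> K * \<delta> powr (- \<alpha>)"
    and \<delta>: "0 < \<delta>"
  obtains W where "W \<in> sets lborel" "emeasure lborel W \<le> ennreal (K * 2 powr \<alpha> / (1 - 2 powr (\<alpha> - 1)) * \<delta> powr (1 - \<alpha>))"
    "\<Union>(gaps E c d 0 - gaps E c d \<delta>) \<subseteq> W"
proof -
  define r :: real where "r = 2 powr (\<alpha> - 1)"
  have r: "0 < r" "r < 1"
    using \<alpha> by (auto simp: r_def powr_less_one)
  \<comment> \<open>\<open>\<G> j\<close> collects the gaps of length in \<open>[D j / 2, D j)\<close>.\<close>
  define D where "D j = \<delta> * (1 / 2) ^ j" for j :: nat
  have D: "0 < D j" "D (Suc j) = D j / 2" for j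
    using \<delta> by (auto simp: D_def)
  define \<G> where "\<G> j = gaps E c d (D (Suc j)) - gaps E c d (D j)" for j
  have \<G>_fin: "finite (\<G> j)" for j
    using fin[OF D(1)] by (simp add: \<G>_def)
  have I_open: "I \<in> sets lborel" if "I \<in> components (- E)" for I
  proof -
    have "open I" using open_components[of "- E" I] E that by (simp add: open_Compl)
    then show ?thesis by simp
  qed
  have \<G>_meas: "I \<in> sets lborel" if "I \<in> \<G> j" for I j
    using that I_open by (auto simp: \<G>_def gaps_def)
  have "emeasure lborel (\<Union>(\<G> j)) \<le> ennreal (K * 2 powr \<alpha> * \<delta> powr (1 - \<alpha>) * r ^ j)" for j
  proof -
    have "emeasure lborel (\<Union>I\<in>\<G> j. I) \<le> (\<Sum>I\<in>\<G> j. emeasure lborel I)"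
      using \<G>_fin \<G>_meas by (intro emeasure_subadditive_finite) auto
    also have "\<dots> \<le> (\<Sum>I\<in>\<G> j. ennreal (D j))"
    proof (rule sum_mono)
      fix I assume "I \<in> \<G> j"
      then have I: "I \<in> components (- E)" "I \<subseteq> {c..d}" "measure lborel I < D j"
        by (auto simp: \<G>_def gaps_def)
      obtain a b where ab: "a < b" "I = {a<..<b}"
        using component_real_cases[OF E I(1,2)] .
      then show "emeasure lborel I \<le> ennreal (D j)"
        using I(3) by (simp add: ennreal_leI)
    qed
    also have "\<dots> = ennreal (card (\<G> j) * D j)"
      using D by (simp add: ennreal_mult' ennreal_of_nat_eq_real_of_nat)
    also have "\<dots> \<le> ennreal (K * 2 powr \<alpha> * \<delta> powr (1 - \<alpha>) * r ^ j)"
    proof (rule ennreal_leI)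
      have "card (\<G> j) \<le> card (gaps E c d (D (Suc j)))"
        unfolding \<G>_def by (intro card_mono fin D) auto
      then have "real (card (\<G> j)) \<le> K * D (Suc j) powr (- \<alpha>)"
        using card[OF D(1), of "Suc j"] by linarith
      then have "card (\<G> j) * D j \<le> K * D (Suc j) powr (- \<alpha>) * D j"
        using D(1)[of j] by (intro mult_right_mono) auto
      also have "\<dots> = K * 2 powr \<alpha> * D j powr (1 - \<alpha>)"
        using D(1)[of j] by (simp add: D(2) powr_divide powr_minus powr_diff field_simps)
      also have "D j powr (1 - \<alpha>) = \<delta> powr (1 - \<alpha>) * r ^ j"
      proof -
        have "(1 / 2 :: real) ^ j = 2 powr (- real j)"
          by (simp add: powr_minus powr_realpow power_one_over inverse_eq_divide)
        then have "((1 / 2 :: real) ^ j) powr (1 - \<alpha>) = 2 powr ((\<alpha> - 1) * real j)"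
          by (simp add: powr_powr algebra_simps)
        also have "\<dots> = r ^ j"
          by (simp add: r_def powr_powr[symmetric] powr_realpow)
        finally show ?thesis
          using \<delta> by (simp add: D_def powr_mult)
      qed
      finally show "card (\<G> j) * D j \<le> K * 2 powr \<alpha> * \<delta> powr (1 - \<alpha>) * r ^ j"
        by (simp add: mult.assoc)
    qed
    finally show ?thesis by simp
  qed
  then have le: "(\<Sum>j. emeasure lborel (\<Union>(\<G> j))) \<le> (\<Sum>j. ennreal (K * 2 powr \<alpha> * \<delta> powr (1 - \<alpha>) * r ^ j))"
    by (intro suminf_le) auto
  let ?W = "\<Union>j. \<Union>(\<G> j)"
  have U_sets: "\<Union>(\<G> j) \<in> sets lborel" for j
    using \<G>_fin \<G>_meas by (intro sets.finite_Union) auto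
  show ?thesis
  proof (rule that)
    show "?W \<in> sets lborel"
      using U_sets by auto
    have "emeasure lborel ?W \<le> (\<Sum>j. emeasure lborel (\<Union>(\<G> j)))"
      using U_sets by (intro emeasure_subadditive_countably) auto
    also note le
    also have "(\<Sum>j. ennreal (K * 2 powr \<alpha> * \<delta> powr (1 - \<alpha>) * r ^ j))
        = ennreal (K * 2 powr \<alpha> * \<delta> powr (1 - \<alpha>) * (1 / (1 - r)))"
      using r K by (intro suminf_ennreal_eq sums_mult geometric_sums) auto
    finally show "emeasure lborel ?W \<le> ennreal (K * 2 powr \<alpha> / (1 - 2 powr (\<alpha> - 1)) * \<delta> powr (1 - \<alpha>))"
      by (simp add: r_def field_simps)
    show "\<Union>(gaps E c d 0 - gaps E c d \<delta>) \<subseteq> ?W"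
    proof (rule Union_least)
      fix I assume "I \<in> gaps E c d 0 - gaps E c d \<delta>"
      then have I': "I \<in> components (- E)" "I \<subseteq> {c..d}" "measure lborel I < \<delta>"
        by (auto simp: gaps_def)
      obtain a b where "a < b" "I = {a<..<b}"
        using component_real_cases[OF E I'(1,2)] .
      then have pos: "0 < measure lborel I" by simp
      have "D \<longlonglongrightarrow> \<delta> * 0"
        unfolding D_def by (intro tendsto_mult tendsto_const LIMSEQ_power_zero) auto
      then have "eventually (\<lambda>j. D j < measure lborel I) sequentially"
        using pos by (intro order_tendstoD) auto
      then obtain n where "D n \<le> measure lborel I"
        by (meson eventually_sequentially less_imp_le order_refl)
      moreover have "\<not> D 0 \<le> measure lborel I"
        using I'(3) by (simp add: D_def)
      \<comment> \<open>The scales start at \<delta>, above the length of \<open>I\<close>, and fall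
        to 0, so some consecutive pair encloses that length.\<close>
      ultimately obtain j where "\<not> D j \<le> measure lborel I" "D (Suc j) \<le> measure lborel I"
        using ex_least_nat_less[of "\<lambda>n. D n \<le> measure lborel I" n] by auto
      then have "I \<in> \<G> j"
        using I' by (auto simp: \<G>_def gaps_def)
      then show "I \<subseteq> ?W" by blast
    qed
  qed
qed

text \<open>In \<open>C\<close> the summand 1 accounts for the marked point \<open>d\<close>,
  \<open>2 * K\<close> for the two endpoints of each long gap, and the last summand for the cells
  filled by short gaps.\<close>

lemma finite_cells_cover:
  fixes E :: "real set"
  assumes E: "closed E" "emeasure lborel E = 0" and cd: "c \<in> E" "d \<in> E" "c \<le> d"
    and \<alpha>: "0 < \<alpha>" "\<alpha> < 1" and K: "0 \<le> K"
    and fin: "\<And>\<delta>. 0 < \<delta> \<Longrightarrow> finite (gaps E c d \<delta>)"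
    and card: "\<And>\<delta>. 0 < \<delta> \<Longrightarrow> real (card (gaps E c d \<delta>)) \<le> K * \<delta> powr (- \<alpha>)"
    and \<delta>: "0 < \<delta>" "\<delta> \<le> 1"
  defines "C \<equiv> 1 + 2 * K + K * 2 powr \<alpha> / (1 - 2 powr (\<alpha> - 1))"
  obtains T :: "nat set" where "finite T" "real (card T) \<le> C * \<delta> powr (- \<alpha>)"
    "E \<inter> {c..d} \<subseteq> (\<Union>i\<in>T. {c + real i * \<delta>..<c + (real i + 1) * \<delta>})"
proof -
  let ?C1 = "K * 2 powr \<alpha> / (1 - 2 powr (\<alpha> - 1))"
  define Q where "Q i = {c + real i * \<delta>..<c + (real i + 1) * \<delta>}" for i :: nat
  have Q_meas: "Q i \<in> sets lborel" for i
    by (simp add: Q_def)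
  \<comment> \<open>The number of the half-open cell containing \<open>x\<close>, for
    \<open>x\<close> at or beyond \<open>c\<close>. Its uniqueness yields both the disjointness of
    the cells and the bound on the number of marked ones.\<close>
  define ix where "ix x = nat \<lfloor>(x - c) / \<delta>\<rfloor>" for x
  have ix: "i = ix x" if "x \<in> Q i" for x i
  proof -
    have "real i \<le> (x - c) / \<delta>" "(x - c) / \<delta> < real i + 1"
      using that \<delta> by (auto simp: Q_def field_simps)
    then have "\<lfloor>(x - c) / \<delta>\<rfloor> = int i"
      by (intro floor_unique) auto
    then show ?thesis by (simp add: ix_def)
  qed
  have in_Q: "x \<in> Q (ix x)" if "c \<le> x" for x
  proof -
    have "0 \<le> (x - c) / \<delta>" using that \<delta> by simp
    then have "real (ix x) \<le> (x - c) / \<delta>" "(x - c) / \<delta> < real (ix x) + 1"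
      by (simp_all add: ix_def)
    then show ?thesis
      using \<delta> by (auto simp: Q_def field_simps)
  qed
  define T where "T = {i. Q i \<inter> E \<inter> {c..d} \<noteq> {}}"
  \<comment> \<open>The point \<open>d\<close> is marked as well, since a cell containing it may
    extend beyond [c, d], where gaps are not controlled. No such care is needed at \<open>c\<close>,
    where the grid starts.\<close>
  define P where "P = insert d (Inf ` gaps E c d \<delta> \<union> Sup ` gaps E c d \<delta>)"
  define T1 where "T1 = {i \<in> T. Q i \<inter> P \<noteq> {}}"
  define T2 where "T2 = {i \<in> T. Q i \<inter> P = {}}"
  have P_fin: "finite P" using fin[OF \<delta>(1)] by (simp add: P_def)
  have P_card: "card P \<le> 1 + 2 * card (gaps E c d \<delta>)"
  proof -
    have "card P \<le> Suc (card (Inf ` gaps E c d \<delta> \<union> Sup ` gaps E c d \<delta>))"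
      unfolding P_def using fin[OF \<delta>(1)] by (simp add: card_insert_if)
    also have "\<dots> \<le> Suc (card (Inf ` gaps E c d \<delta>) + card (Sup ` gaps E c d \<delta>))"
      using card_Un_le by auto
    also have "\<dots> \<le> 1 + 2 * card (gaps E c d \<delta>)"
      using card_image_le[OF fin[OF \<delta>(1)], of Inf] card_image_le[OF fin[OF \<delta>(1)], of Sup] by linarith
    finally show ?thesis .
  qed
  have "T1 \<subseteq> ix ` P"
  proof
    fix i assume "i \<in> T1"
    then obtain x where x: "x \<in> Q i" "x \<in> P" by (auto simp: T1_def)
    show "i \<in> ix ` P" using ix[OF x(1)] x(2) by (rule image_eqI)
  qed
  then have T1: "finite T1" "card T1 \<le> card P"
    using P_fin by (auto intro: finite_subset surj_card_le)
  have T_sub: "T \<subseteq> {..ix d}"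
  proof
    fix i assume "i \<in> T"
    then obtain x where x: "x \<in> Q i" "c \<le> x" "x \<le> d" by (auto simp: T_def)
    then have "ix x \<le> ix d"
      unfolding ix_def using \<delta> by (intro nat_mono floor_mono divide_right_mono) auto
    then show "i \<in> {..ix d}" using ix[OF x(1)] by simp
  qed
  then have T_fin: "finite T" by (rule finite_subset) simp
  then have T2_fin: "finite T2" by (simp add: T2_def)
  obtain W where W: "W \<in> sets lborel" "emeasure lborel W \<le> ennreal (?C1 * \<delta> powr (1 - \<alpha>))"
    "\<Union>(gaps E c d 0 - gaps E c d \<delta>) \<subseteq> W"
    by (rule countable_cover_small_gaps[OF E(1) cd(1,2) \<alpha> K fin card \<delta>(1)])
  have Q_sub: "Q i \<subseteq> E \<union> W" if i: "i \<in> T2" for i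
  proof
    fix y assume y: "y \<in> Q i"
    obtain x where x: "x \<in> Q i" "x \<in> E" "x \<le> d"
      using i by (auto simp: T2_def T_def)
    have "d \<notin> Q i" using i by (auto simp: T2_def P_def)
    then have yd: "c \<le> y" "y \<le> d"
      using x y \<delta> by (auto simp: Q_def intro: order_trans[of c "c + real i * \<delta>"])
    show "y \<in> E \<union> W"
    proof (cases "y \<in> E")
      case False
      then obtain I where I: "I \<in> components (- E)" "y \<in> I"
        using Union_components[of "- E"] by blast
      have Icd: "I \<subseteq> {c..d}"
        using component_subset_interval[OF I(1) cd(1,2) I(2) yd] .
      obtain a b where ab: "a < b" "I = {a<..<b}"
        using component_real_cases[OF E(1) I(1) Icd] .
      \<comment> \<open>A long gap through \<open>y\<close> with both endpoints outside the cell
        would swallow the whole cell, including the point \<open>x\<close> of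
        \<open>E\<close>.\<close>
      have "I \<notin> gaps E c d \<delta>"
      proof
        assume "I \<in> gaps E c d \<delta>"
        then have "Inf I \<in> P" "Sup I \<in> P" by (auto simp: P_def)
        then have "a \<notin> Q i" "b \<notin> Q i"
          using i ab by (auto simp: T2_def)
        moreover have "x \<notin> I"
          using in_components_subset[OF I(1)] x(2) by auto
        ultimately show False
          using x(1) y I(2) unfolding ab(2) Q_def by auto
      qed
      moreover have "I \<in> gaps E c d 0"
        using I Icd by (simp add: gaps_def)
      ultimately show ?thesis
        using W(3) I(2) by auto
    qed simp
  qed
  \<comment> \<open>The unmarked cells are disjoint and lie in \<open>E \<union> W\<close>, where
    \<open>E\<close> is null, so their total length is at most the measure of
    \<open>W\<close>.\<close>
  have le: "real (card T2) * \<delta> \<le> ?C1 * \<delta> powr (1 - \<alpha>)"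
  proof -
    have "disjoint_family_on Q T2"
      unfolding disjoint_family_on_def
    proof (intro ballI impI equals0I)
      fix i j x assume "i \<noteq> j" "x \<in> Q i \<inter> Q j"
      then show False using ix[of x i] ix[of x j] by auto
    qed
    then have "(\<Sum>i\<in>T2. emeasure lborel (Q i)) = emeasure lborel (\<Union>i\<in>T2. Q i)"
      using T2_fin by (intro sum_emeasure image_subsetI Q_meas)
    also have "\<dots> \<le> emeasure lborel (E \<union> W)"
      using Q_sub W(1) E(1) by (intro emeasure_mono) auto
    also have "\<dots> \<le> emeasure lborel E + emeasure lborel W"
      using E(1) W(1) by (intro emeasure_subadditive) auto
    also have "\<dots> \<le> ennreal (?C1 * \<delta> powr (1 - \<alpha>))"
      using E(2) W(2) by simp
    also have "(\<Sum>i\<in>T2. emeasure lborel (Q i)) = (\<Sum>i\<in>T2. ennreal \<delta>)"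
      using \<delta> by (intro sum.cong refl) (simp add: Q_def algebra_simps)
    also have "\<dots> = ennreal (real (card T2) * \<delta>)"
      using \<delta> by (simp add: ennreal_mult' ennreal_of_nat_eq_real_of_nat)
    finally have "ennreal (real (card T2) * \<delta>) \<le> ennreal (?C1 * \<delta> powr (1 - \<alpha>))" .
    moreover have "2 powr (\<alpha> - 1) < (1::real)"
      using \<alpha> by (simp add: powr_less_one)
    ultimately show ?thesis
      using K by (simp add: ennreal_le_iff)
  qed
  have T2: "real (card T2) \<le> ?C1 * \<delta> powr (- \<alpha>)"
  proof -
    have "\<delta> powr (1 - \<alpha>) = \<delta> powr (- \<alpha>) * \<delta>"
      using \<delta> by (simp add: powr_diff powr_minus divide_inverse)
    with le have "real (card T2) * \<delta> \<le> ?C1 * \<delta> powr (- \<alpha>) * \<delta>"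
      by (simp only: mult.assoc)
    then show ?thesis
      using \<delta>(1) by (rule mult_right_le_imp_le)
  qed
  have "T = T1 \<union> T2" by (auto simp: T1_def T2_def)
  then have "real (card T) \<le> real (card T1) + real (card T2)"
    using card_Un_le[of T1 T2] by simp
  also have "\<dots> \<le> 1 + 2 * (K * \<delta> powr (- \<alpha>)) + ?C1 * \<delta> powr (- \<alpha>)"
    using T1(2) P_card card[OF \<delta>(1)] T2 by linarith
  also have "\<dots> \<le> C * \<delta> powr (- \<alpha>)"
  proof -
    \<comment> \<open>This is where \<open>\<delta> \<le> 1\<close> enters: it absorbs the cell of
      the marked point \<open>d\<close> into the power.\<close>
    have "1 \<le> \<delta> powr (- \<alpha>)"
      using \<delta> \<alpha> powr_mono2'[of "- \<alpha>" \<delta> 1] by simp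
    then show ?thesis by (simp add: C_def algebra_simps)
  qed
  finally have "real (card T) \<le> C * \<delta> powr (- \<alpha>)" .
  moreover have "E \<inter> {c..d} \<subseteq> (\<Union>i\<in>T. Q i)"
  proof
    fix x assume x: "x \<in> E \<inter> {c..d}"
    then have "x \<in> Q (ix x)" using in_Q by auto
    then show "x \<in> (\<Union>i\<in>T. Q i)"
      using x by (intro UN_I[of "ix x"]) (auto simp: T_def)
  qed
  ultimately show ?thesis
    using that T_fin unfolding Q_def by blast
qed

section \<open>Passage from grid covers to Hausdorff dimension\<close>

text \<open>A grid of mesh \<eta> gives at most C \<eta>^(-\<alpha>) sets of diameter at most
  \<eta>, hence a sum of at most C \<eta>^(s - \<alpha>), which tends to 0 with \<eta> because
  \<open>\<alpha> < s\<close>.\<close>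

lemma hausdorff_premeasure_interval_eq_0:
  fixes E :: "real set"
  assumes E: "closed E" "emeasure lborel E = 0" and cd: "c \<in> E" "d \<in> E" "c \<le> d"
    and \<alpha>: "0 < \<alpha>" "\<alpha> < 1" and K: "0 \<le> K"
    and fin: "\<And>\<delta>. 0 < \<delta> \<Longrightarrow> finite (gaps E c d \<delta>)"
    and card: "\<And>\<delta>. 0 < \<delta> \<Longrightarrow> real (card (gaps E c d \<delta>)) \<le> K * \<delta> powr (- \<alpha>)"
    and "\<alpha> < s" "0 < \<delta>"
  shows "hausdorff_premeasure s \<delta> (E \<inter> {c..d}) = 0"
proof -
  define C where "C = 1 + 2 * K + K * 2 powr \<alpha> / (1 - 2 powr (\<alpha> - 1))"
  \<comment> \<open>The meshes stay below \<open>\<delta>\<close>, so that the covers are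
    admissible, and below 1, as the cell count demands.\<close>
  define \<eta> where "\<eta> n = min 1 \<delta> * (1 / 2) ^ n" for n :: nat
  have \<eta>: "0 < \<eta> n" "\<eta> n \<le> 1" "\<eta> n \<le> \<delta>" for n
  proof -
    show "0 < \<eta> n" using \<open>0 < \<delta>\<close> by (simp add: \<eta>_def)
    have "\<eta> n \<le> min 1 \<delta> * 1"
      unfolding \<eta>_def using \<open>0 < \<delta>\<close> by (intro mult_left_mono power_le_one) auto
    then show "\<eta> n \<le> 1" "\<eta> n \<le> \<delta>" by auto
  qed
  have "hausdorff_premeasure s \<delta> (E \<inter> {c..d}) \<le> ennreal (C * \<eta> n powr (s - \<alpha>))" for n
  proof -
    let ?Q = "\<lambda>i. {c + real i * \<eta> n..<c + (real i + 1) * \<eta> n}"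
    obtain T :: "nat set" where T: "finite T" "real (card T) \<le> C * \<eta> n powr (- \<alpha>)"
      "E \<inter> {c..d} \<subseteq> (\<Union>i\<in>T. ?Q i)"
      by (rule finite_cells_cover[OF E cd \<alpha> K fin card \<eta>(1,2), folded C_def])
    have "hausdorff_premeasure s \<delta> (E \<inter> {c..d}) \<le> ennreal (card T * \<eta> n powr s)"
    proof (rule hausdorff_premeasure_le_finite_cover[OF T(1,3)])
      show "diameter (?Q i) \<le> \<eta> n" for i
        by (rule diameter_le) (use \<eta>(1)[of n] in \<open>auto simp: algebra_simps abs_le_iff\<close>)
    qed (use \<eta>[of n] assms in \<open>auto intro: less_imp_le\<close>)
    also have "\<dots> \<le> ennreal (C * \<eta> n powr (s - \<alpha>))"
    proof (rule ennreal_leI)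
      have "card T * \<eta> n powr s \<le> C * \<eta> n powr (- \<alpha>) * \<eta> n powr s"
        by (intro mult_right_mono T) auto
      then show "card T * \<eta> n powr s \<le> C * \<eta> n powr (s - \<alpha>)"
        using \<eta>(1)[of n] by (simp add: powr_add[symmetric] mult.assoc)
    qed
    finally show ?thesis .
  qed
  moreover have "(\<lambda>n. ennreal (C * \<eta> n powr (s - \<alpha>))) \<longlonglongrightarrow> ennreal (C * 0)"
  proof (intro tendsto_ennrealI tendsto_mult tendsto_const)
    have "\<eta> \<longlonglongrightarrow> min 1 \<delta> * 0"
      unfolding \<eta>_def by (intro tendsto_mult tendsto_const LIMSEQ_power_zero) auto
    then show "(\<lambda>n. \<eta> n powr (s - \<alpha>)) \<longlonglongrightarrow> 0"
      using \<open>\<alpha> < s\<close> by (intro tendsto_zero_powrI[where b = "s - \<alpha>"])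
        (auto intro!: always_eventually less_imp_le[OF \<eta>(1)])
  qed
  ultimately have "hausdorff_premeasure s \<delta> (E \<inter> {c..d}) \<le> ennreal (C * 0)"
    by (intro LIMSEQ_le_const) auto
  then show ?thesis by simp
qed

lemma LP_p_imp_hausdorff_dim_le:
  assumes p: "1 < p" "p < 2" and q: "1 / p + 1 / q = 1" and LP: "LP_p p E"
  shows "hausdorff_dim E \<le> ereal (2 / q)"
proof -
  define \<alpha> where "\<alpha> = 2 * (p - 1) / p"
  have \<alpha>q: "\<alpha> = 2 / q"
  proof -
    have "1 / q = 1 - 1 / p"
      using q by linarith
    also have "\<dots> = (p - 1) / p"
      using p by (simp add: field_simps)
    finally have "2 * (1 / q) = 2 * ((p - 1) / p)"
      by (rule arg_cong)
    then show ?thesis by (simp add: \<alpha>_def)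
  qed
  have \<alpha>: "0 < \<alpha>" "\<alpha> < 1"
    using p by (auto simp: \<alpha>_def field_simps)
  have E: "closed E" "emeasure lborel E = 0"
    using LP by (auto simp: LP_p_def)
  have null: "hausdorff_premeasure s \<delta> (E \<inter> {-real n..real n}) = 0" if s: "\<alpha> < s" and \<delta>: "0 < \<delta>" for s \<delta> n
  proof (cases "E \<inter> {-real n..real n} = {}")
    case True
    have "hausdorff_premeasure s \<delta> (E \<inter> {-real n..real n}) \<le> ennreal (card ({}::nat set) * \<delta> powr s)"
      by (rule hausdorff_premeasure_le_finite_cover[where U = "\<lambda>_. {}"]) (use True s \<delta> \<alpha> in auto)
    then show ?thesis by simp
  next
    case False
    let ?A = "E \<inter> {-real n..real n}"
    have compact: "compact ?A"
      using E(1) by (intro closed_Int_compact) auto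
    \<comment> \<open>Replacing -n and n by the extreme points of \<open>E\<close> between them puts
      both ends of the interval into \<open>E\<close>, as the covering argument requires.\<close>
    obtain c where c: "c \<in> ?A" "\<And>x. x \<in> ?A \<Longrightarrow> c \<le> x"
      using compact_attains_inf[OF compact False] by blast
    obtain d where d: "d \<in> ?A" "\<And>x. x \<in> ?A \<Longrightarrow> x \<le> d"
      using compact_attains_sup[OF compact False] by blast
    have A: "?A = E \<inter> {c..d}"
      using c d by auto
    \<comment> \<open>The counting bound needs a nondegenerate interval, but \<open>c = d\<close> is
      possible; enlarging the interval loses no gaps.\<close>
    have "c < d + 1" using c(2)[OF d(1)] by simp
    from LP_p_imp_card_gaps_le[OF p LP this] obtain K where K: "0 \<le> K"
      "\<And>\<delta> F. 0 < \<delta> \<Longrightarrow> finite F \<Longrightarrow> F \<subseteq> gaps E c (d + 1) \<delta> \<Longrightarrow> real (card F) \<le> K * \<delta> powr (- \<alpha>)"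
      unfolding \<alpha>_def by metis
    have sub: "gaps E c d \<delta> \<subseteq> gaps E c (d + 1) \<delta>" for \<delta>
      by (auto simp: gaps_def)
    have fin: "finite (gaps E c d \<delta>)" if "0 < \<delta>" for \<delta>
    proof -
      \<comment> \<open>A bound on the size of all finite subfamilies that does not depend on the
        subfamily forces the whole family to be finite.\<close>
      have "finite F \<and> card F \<le> nat \<lfloor>K * \<delta> powr (- \<alpha>)\<rfloor>" if "F \<subseteq> gaps E c d \<delta>" "finite F" for F
        using K(2)[OF \<open>0 < \<delta>\<close> that(2)] that sub[of \<delta>] by (simp add: le_nat_floor)
      then show ?thesis
        using finite_if_finite_subsets_card_bdd[of "gaps E c d \<delta>" "nat \<lfloor>K * \<delta> powr (- \<alpha>)\<rfloor>"] by blast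
    qed
    have card: "real (card (gaps E c d \<delta>)) \<le> K * \<delta> powr (- \<alpha>)" if "0 < \<delta>" for \<delta>
      by (rule K(2)[OF that fin[OF that] sub])
    have cd: "c \<in> E" "d \<in> E" "c \<le> d"
      using c d by auto
    show ?thesis
      unfolding A by (rule hausdorff_premeasure_interval_eq_0[OF E cd \<alpha> K(1) fin card s \<delta>])
  qed
  have "hausdorff_measure s E = 0" if s: "\<alpha> < s" for s
  proof -
    have "hausdorff_premeasure s \<delta> E = 0" if "0 < \<delta>" for \<delta>
    proof -
      have "E = (\<Union>n. E \<inter> {-real n..real n})"
      proof -
        have "x \<in> (\<Union>n. {-real n..real n})" for x
        proof -
          obtain n where "\<bar>x\<bar> \<le> real n" using real_arch_simple by blast
          then have "x \<in> {-real n..real n}" by (simp add: abs_le_iff)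
          then show ?thesis by blast
        qed
        then show ?thesis by blast
      qed
      then show ?thesis
        using hausdorff_premeasure_countable_Union_eq_0[of s \<delta> "\<lambda>n. E \<inter> {-real n..real n}"]
          null[OF s that] by simp
    qed
    then show ?thesis
      unfolding hausdorff_measure_def by (simp add: SUP_eq_const)
  qed
  then have dim_le: "hausdorff_dim E \<le> ereal s" if "\<alpha> < s" for s
    unfolding hausdorff_dim_def using that \<alpha> by (intro INF_lower) auto
  show ?thesis
    unfolding \<alpha>q[symmetric]
  proof (rule ereal_le_epsilon2)
    show "hausdorff_dim E \<le> ereal \<alpha> + ereal e" if "0 < e" for e
      using dim_le[of "\<alpha> + e"] that by simp
  qed
qed

theorem mainTheorem3:
  shows "(\<forall>(p::real) (q::real) (E::real set).
            1 < p \<and> p < 2 \<and> 1 / p + 1 / q = 1 \<and> LP_p p E \<longrightarrow> hausdorff_dim E \<le> ereal (2 / q)) \<and>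
         (\<forall>E::real set. LP E \<longrightarrow> hausdorff_dim E = 0)"
proof (intro conjI allI impI)
  fix E :: "real set"
  assume LP: "LP E"
  have "hausdorff_dim E \<le> 0 + ereal e" if "0 < e" for e
  proof -
    \<comment> \<open>The minimum with 1 / 2 ensures \<open>4 \<le> q\<close>, so that the conjugate
      exponent \<open>p\<close> lies strictly between 1 and 2, while 2 / q stays below
      \<open>e\<close>.\<close>
    define q where "q = 2 / min e (1 / 2)"
    have q: "4 \<le> q" "2 / q \<le> e"
      using that by (auto simp: q_def min_def field_simps)
    define p where "p = q / (q - 1)"
    have p: "1 < p" "p < 2" "1 / p + 1 / q = 1"
      using q by (auto simp: p_def field_simps)
    have "hausdorff_dim E \<le> ereal (2 / q)"
      using LP p by (intro LP_p_imp_hausdorff_dim_le) (auto simp: LP_def)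
    also have "\<dots> \<le> 0 + ereal e" using q by simp
    finally show ?thesis .
  qed
  then have "hausdorff_dim E \<le> 0"
    by (rule ereal_le_epsilon2)
  moreover have "0 \<le> hausdorff_dim E"
    unfolding hausdorff_dim_def by (intro INF_greatest) auto
  ultimately show "hausdorff_dim E = 0" by simp
qed (elim conjE, rule LP_p_imp_hausdorff_dim_le)

end
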